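(* Let $P$ be a well-behaved guarded GSP process with local state set $S$ and set of guards $\mathcal{G}$, and let $\mathcal{M}_\infty=(\mathbb{N}^S,\rightarrow)$ be the associated infinite-state transition system. Let $\trianglelefteq$ be the order on $\mathbb{N}^S$ defined by $$\mathbf{q}\trianglelefteq\mathbf{p}\iff \bigl(\forall s\in S:\ \mathbf{q}(s)\le\mathbf{p}(s)\bigr)\ \wedge\ \forall G\in\mathcal{G}:\bigl(\mathrm{supp}(\mathbf{q})\subseteq G\iff\mathrm{supp}(\mathbf{p})\subseteq G\bigr),$$ where $\mathrm{supp}(\mathbf{q})=\{s\in S:\mathbf{q}(s)>0\}$. Then $\mathcal{M}_\infty$ (equipped with $\trianglelefteq$) is a well-structured transition system, and one can effectively compute $Pred$.
   Context: **Guarded process.** A guarded (GSP) process is $P=\langle A,S,s_0,T\rangle$ with $S$ a finite set of local states, $s_0\in S$ initial, $T\subseteq S\times A\times\mathcal{P}(S)\times S$; the subset of $S$ labelling a transition is its guard. $A$ is built from a finite set $\mathcal{A}$ of global actions; each $a\in\mathcal{A}$ has an arity $k\ge1$ and is either a *$k$-sender action* or a *$k$-maximal action*. Each $a$ contributes local sending actions $a_1!!,\dots,a_k!!$ and a receiving action $a??$. All local transitions based on $a$ have the same guard $G_a$. Sends are unique: for each $a_i!!$ there is exactly one transition $s_i\xrightarrow{a_i!!,G_a}s_i'$. Receives are deterministic: for each $s\in S$ there is exactly one state, denoted $M_a(s)$, with $s\xrightarrow{a??,G_a}M_a(s)$. Also write $M_a$ for the linear map $(M_a\cdot\mathbf{x})(t)=\sum_{s:M_a(s)=t}\mathbf{x}(s)$.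 Put $\mathbf{v}_a(t)=|\{i:s_i=t\}|$, $\mathbf{v}'_a(t)=|\{i:s'_i=t\}|$, $\hat s'=\{s'_1,\dots,s'_k\}$. $\mathcal{G}$ is the set of all guards occurring on transitions of $P$. An *internal* action is a $1$-sender action with $M_a(s)=s$ for all $s$; its sending transition $s\to s'$ is an internal transition. A transition is unguarded if its guard is $S$. **Global transitions.** Global states are $\mathbf{q}\in\mathbb{N}^S$ (numbers of processes in each local state). Action $a$ is enabled in $\mathbf{q}$ only if $\mathrm{supp}(\mathbf{q})\subseteq G_a$. Under this condition: - if $a$ is $k$-sender, it fires iff $\mathbf{q}(t)\ge\mathbf{v}_a(t)$ for all $t$, and then $\mathbf{q}\xrightarrow{a}M_a\cdot(\mathbf{q}-\mathbf{v}_a)+\mathbf{v}'_a$; - if $a$ is $k$-maximal, $\mathbf{q}\xrightarrow{a}\mathbf{q}'$ iff there is a non-empty $I\subseteq\{1,\dots,k\}$ such that, with $\mathbf{u}(t)=|\{i\in I:s_i=t\}|$ and $\mathbf{u}'(t)=|\{i\in I:s'_i=t\}|$, $\mathbf{u}(t)=\min(\mathbf{q}(t),\mathbf{v}_a(t))$ for all $t$ and $\mathbf{q}'=M_a\cdot(\mathbf{q}-\mathbf{u})+\mathbf{u}'$. $\mathcal{M}_\infty$ has state space $\mathbb{N}^S$, it may start with any number $n\in\mathbb{N}$ of processes, all in $s_0$, and $\mathbf{q}\rightarrow\mathbf{q}'$ iff $\mathbf{q}\xrightarrow{a}\mathbf{q}'$ for some $a\in\mathcal{A}$. **Well-behavedness.**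 For $t,s\in S$, $H\subseteq S$: $t\triangleleft s$ means $\forall G\in\mathcal{G}\,(s\in G\Rightarrow t\in G)$; $t\triangleleft H$ means $\forall G\in\mathcal{G}\,(H\subseteq G\Rightarrow t\in G)$. $s\rightsquigarrow s'$ means there is a path of unguarded internal transitions from $s$ to $s'$. For $G\subseteq S$, $s\rightsquigarrow_G s'$ means there is a path of internal transitions from $s$ to $s'$ such that each transition is guarded by some $G'\supseteq G$. Action $a$ with guard $G$ is (weakly) guard-compatible if: - ($a$ a $k$-sender action) for all $G'\in\mathcal{G}$: $\hat s'\subseteq G'\Rightarrow\forall s\in G:\bigl(M_a(s)\in G'\ \vee\ \exists r\in S:(r\triangleleft\hat s'\wedge M_a(s)\rightsquigarrow r)\bigr)$; - ($a$ a $k$-maximal action) for all $G'\in\mathcal{G}$: $\hat s'\cap G'\ne\varnothing\Rightarrow\bigl(\hat s'\subseteq G'\wedge\forall s\in G:\bigl(M_a(s)\in G'\vee\exists r\in S:((\forall i:\ r\triangleleft s'_i)\wedge M_a(s)\rightsquigarrow r)\bigr)\bigr)$; - ($a$ an internal action with sending transition $s\to s'$) it suffices, instead of the first condition, that for all $G'\in\mathcal{G}$ and all $t\in G$: $(s\notin G'\wedge s'\in G')\Rightarrow\exists t'\in S:(t'\triangleleft s'\wedge t\rightsquigarrow_{G''}t')$, where $G''=G\cup\{r\in S: r\triangleleft s'\}$. $P$ is well-behaved if every action is (weakly) guard-compatible. **WSTS.** A well-quasi-order (WQO) on $Q$ is a reflexive transitive relation $\le$ such that every infinite sequence $\mathbf{q}_0,\mathbf{q}_1,\dots$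 has $i<j$ with $\mathbf{q}_i\le\mathbf{q}_j$. It is compatible with $\rightarrow$ if whenever $\mathbf{q}\le\mathbf{p}$ and $\mathbf{q}\rightarrow\mathbf{q}'$ there is $\mathbf{p}'$ with $\mathbf{q}'\le\mathbf{p}'$ and $\mathbf{p}\rightarrow^*\mathbf{p}'$. A transition system with a compatible WQO is a well-structured transition system (WSTS). **Effective $Pred$.** For $U\subseteq Q$, $\uparrow U=\{\mathbf{p}\in Q:\exists\mathbf{q}\in U,\ \mathbf{q}\le\mathbf{p}\}$; $U$ is upwards closed if $\uparrow U=U$. A finite basis of an upwards-closed set $U$ is a finite set $B\subseteq U$ with $\uparrow B=U$. $Pred(U)$ is the set of predecessor states of $U$ with respect to $\rightarrow$. One can effectively compute $Pred$ if there is an algorithm that computes a finite basis of $Pred(U)$ from any finite basis of any upwards-closed $U\subseteq Q$.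
   Formalization: Guarded internal paths use only transitions whose source lies in their own guard (others never fire, and admitting them breaks compatibility); the algorithm returns a finite subset of Pred(U) with the same upward closure as Pred(U), since Pred(U) need not be upwards closed. *)

theory Defs
  imports Main "HOL-Library.Nat_Bijection"
begin

section \<open>Guarded processes\<close>

datatype 'a local_action = Send 'a nat | Recv 'a

primrec base :: "'a local_action \<Rightarrow> 'a" where
  "base (Send a i) = a"
| "base (Recv a) = a"

text \<open>
  The component \<open>maximal\<close> tells the two kinds of global actions apart:
  \<open>maximal P a\<close> means that \<open>a\<close> is an \<open>arity P a\<close>-maximal action, and
  \<open>\<not> maximal P a\<close> that it is an \<open>arity P a\<close>-sender action.
\<close>

record ('s, 'a) gsp =
  global_actions :: "'a set"
  arity :: "'a \<Rightarrow> nat"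
  maximal :: "'a \<Rightarrow> bool"
  states :: "'s set"
  init :: 's
  trans_rel :: "('s \<times> 'a local_action \<times> 's set \<times> 's) set"

definition local_actions :: "('s, 'a) gsp \<Rightarrow> 'a local_action set" where
  "local_actions P =
     {Send a i | a i. a \<in> global_actions P \<and> 1 \<le> i \<and> i \<le> arity P a} \<union>
     {Recv a | a. a \<in> global_actions P}"

definition gsp_process :: "('s, 'a) gsp \<Rightarrow> bool" where
  "gsp_process P \<longleftrightarrow>
     finite (states P) \<and> init P \<in> states P \<and> finite (global_actions P) \<and>
     trans_rel P \<subseteq> states P \<times> local_actions P \<times> Pow (states P) \<times> states P \<and>
     (\<forall>a\<in>global_actions P.
        1 \<le> arity P a \<and>
        (\<exists>G. \<forall>s l H s'. (s, l, H, s') \<in> trans_rel P \<and> base l = a \<longrightarrow> H = G) \<and>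
        (\<forall>i\<in>{1..arity P a}. \<exists>!(s, G, s'). (s, Send a i, G, s') \<in> trans_rel P) \<and>
        (\<forall>s\<in>states P. \<exists>!s'. \<exists>G. (s, Recv a, G, s') \<in> trans_rel P))"

text \<open>\<open>guard_of\<close>, \<open>src\<close>, \<open>tgt\<close> and \<open>recv_state\<close> are meaningful only under \<open>gsp_process\<close>.\<close>

definition guard_of :: "('s, 'a) gsp \<Rightarrow> 'a \<Rightarrow> 's set" where
  "guard_of P a = (THE G. \<exists>s l s'. (s, l, G, s') \<in> trans_rel P \<and> base l = a)"

definition src :: "('s, 'a) gsp \<Rightarrow> 'a \<Rightarrow> nat \<Rightarrow> 's" where
  "src P a i = (THE s. \<exists>G s'. (s, Send a i, G, s') \<in> trans_rel P)"

definition tgt :: "('s, 'a) gsp \<Rightarrow> 'a \<Rightarrow> nat \<Rightarrow> 's" where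
  "tgt P a i = (THE s'. \<exists>s G. (s, Send a i, G, s') \<in> trans_rel P)"

definition recv_state :: "('s, 'a) gsp \<Rightarrow> 'a \<Rightarrow> 's \<Rightarrow> 's" where
  "recv_state P a s = (THE s'. \<exists>G. (s, Recv a, G, s') \<in> trans_rel P)"

definition tgts :: "('s, 'a) gsp \<Rightarrow> 'a \<Rightarrow> 's set" where
  "tgts P a = tgt P a ` {1..arity P a}"

definition guards :: "('s, 'a) gsp \<Rightarrow> 's set set" where
  "guards P = {G. \<exists>s l s'. (s, l, G, s') \<in> trans_rel P}"

definition internal :: "('s, 'a) gsp \<Rightarrow> 'a \<Rightarrow> bool" where
  "internal P a \<longleftrightarrow> \<not> maximal P a \<and> arity P a = 1 \<and> (\<forall>s\<in>states P. recv_state P a s = s)"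


section \<open>Global transitions\<close>

text \<open>
  A global state is a function that vanishes outside \<open>states P\<close>, so that
  \<open>configs P\<close> is in bijection with the functions from \<open>states P\<close> to the natural numbers.
\<close>

definition configs :: "('s, 'a) gsp \<Rightarrow> ('s \<Rightarrow> nat) set" where
  "configs P = {q. \<forall>s. s \<notin> states P \<longrightarrow> q s = 0}"

definition supp :: "('s \<Rightarrow> nat) \<Rightarrow> 's set" where
  "supp q = {s. q s > 0}"

definition recv_map :: "('s, 'a) gsp \<Rightarrow> 'a \<Rightarrow> ('s \<Rightarrow> nat) \<Rightarrow> 's \<Rightarrow> nat" where
  "recv_map P a x t = (\<Sum>s | s \<in> states P \<and> recv_state P a s = t. x s)"

text \<open>
  With \<open>I = {1..arity P a}\<close> these are the vectors of sources and of targets of all the sending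
  transitions of \<open>a\<close>.
\<close>

definition src_vec :: "('s, 'a) gsp \<Rightarrow> 'a \<Rightarrow> nat set \<Rightarrow> 's \<Rightarrow> nat" where
  "src_vec P a I t = card {i \<in> I. src P a i = t}"

definition tgt_vec :: "('s, 'a) gsp \<Rightarrow> 'a \<Rightarrow> nat set \<Rightarrow> 's \<Rightarrow> nat" where
  "tgt_vec P a I t = card {i \<in> I. tgt P a i = t}"

text \<open>Where \<open>step_by\<close> uses \<open>fire\<close>, the subtraction on \<open>nat\<close> is exact.\<close>

definition fire :: "('s, 'a) gsp \<Rightarrow> 'a \<Rightarrow> nat set \<Rightarrow> ('s \<Rightarrow> nat) \<Rightarrow> 's \<Rightarrow> nat" where
  "fire P a I q t = recv_map P a (\<lambda>s. q s - src_vec P a I s) t + tgt_vec P a I t"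

definition step_by :: "('s, 'a) gsp \<Rightarrow> 'a \<Rightarrow> ('s \<Rightarrow> nat) \<Rightarrow> ('s \<Rightarrow> nat) \<Rightarrow> bool" where
  "step_by P a q q' \<longleftrightarrow>
     q \<in> configs P \<and> supp q \<subseteq> guard_of P a \<and>
     (if maximal P a
      then \<exists>I. I \<noteq> {} \<and> I \<subseteq> {1..arity P a} \<and>
               (\<forall>t\<in>states P. src_vec P a I t = min (q t) (src_vec P a {1..arity P a} t)) \<and>
               q' = fire P a I q
      else (\<forall>t\<in>states P. q t \<ge> src_vec P a {1..arity P a} t) \<and>
           q' = fire P a {1..arity P a} q)"

definition step :: "('s, 'a) gsp \<Rightarrow> ('s \<Rightarrow> nat) \<Rightarrow> ('s \<Rightarrow> nat) \<Rightarrow> bool" where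
  "step P q q' \<longleftrightarrow> (\<exists>a\<in>global_actions P. step_by P a q q')"

definition config_le :: "('s, 'a) gsp \<Rightarrow> ('s \<Rightarrow> nat) \<Rightarrow> ('s \<Rightarrow> nat) \<Rightarrow> bool" where
  "config_le P q p \<longleftrightarrow>
     (\<forall>s\<in>states P. q s \<le> p s) \<and> (\<forall>G\<in>guards P. supp q \<subseteq> G \<longleftrightarrow> supp p \<subseteq> G)"


section \<open>Well-behavedness\<close>

text \<open>
  \<open>weaker P t s\<close> and \<open>weaker_set P t H\<close> are the relations \<open>t \<triangleleft> s\<close> and \<open>t \<triangleleft> H\<close>:
  \<open>t\<close> lies in every guard that contains \<open>s\<close>, respectively in every guard that includes \<open>H\<close>.
\<close>

definition weaker :: "('s, 'a) gsp \<Rightarrow> 's \<Rightarrow> 's \<Rightarrow> bool" where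
  "weaker P t s \<longleftrightarrow> (\<forall>G\<in>guards P. s \<in> G \<longrightarrow> t \<in> G)"

definition weaker_set :: "('s, 'a) gsp \<Rightarrow> 's \<Rightarrow> 's set \<Rightarrow> bool" where
  "weaker_set P t H \<longleftrightarrow> (\<forall>G\<in>guards P. H \<subseteq> G \<longrightarrow> t \<in> G)"

definition internal_trans :: "('s, 'a) gsp \<Rightarrow> 's set \<Rightarrow> 's \<Rightarrow> 's \<Rightarrow> bool" where
  "internal_trans P G s s' \<longleftrightarrow>
     (\<exists>a\<in>global_actions P. internal P a \<and> (s, Send a 1, G, s') \<in> trans_rel P)"

definition unguarded_path :: "('s, 'a) gsp \<Rightarrow> 's \<Rightarrow> 's \<Rightarrow> bool" where
  "unguarded_path P = (internal_trans P (states P))\<^sup>*\<^sup>*"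

text \<open>
  In a path guarded by \<open>G\<close>, the source of every transition is required to lie in the guard of
  that transition. The enabling condition \<open>supp q \<subseteq> guard_of P a\<close> also covers the moving
  process itself, so a transition violating this requirement can never fire. For unguarded
  transitions the requirement always holds. If paths through such dead transitions were
  admitted, well-behavedness would not imply compatibility: take internal transitions
  \<open>0 \<rightarrow> 1\<close> with guard \<open>{0}\<close>, \<open>0 \<rightarrow> 2\<close> with guard \<open>{0, 1}\<close>, \<open>2 \<rightarrow> 1\<close> with guard \<open>{0, 1}\<close> (dead)
  and \<open>1 \<rightarrow> 1\<close> with guard \<open>{1}\<close>, and compare one process in \<open>0\<close> with two processes in \<open>0\<close>.
\<close>

definition guarded_path :: "('s, 'a) gsp \<Rightarrow> 's set \<Rightarrow> 's \<Rightarrow> 's \<Rightarrow> bool" where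
  "guarded_path P G = (\<lambda>s s'. \<exists>G'. G \<subseteq> G' \<and> s \<in> G' \<and> internal_trans P G' s s')\<^sup>*\<^sup>*"

definition sender_compatible :: "('s, 'a) gsp \<Rightarrow> 'a \<Rightarrow> bool" where
  "sender_compatible P a \<longleftrightarrow>
     (\<forall>G'\<in>guards P. tgts P a \<subseteq> G' \<longrightarrow>
        (\<forall>s\<in>guard_of P a.
           recv_state P a s \<in> G' \<or>
           (\<exists>r\<in>states P. weaker_set P r (tgts P a) \<and> unguarded_path P (recv_state P a s) r)))"

definition maximal_compatible :: "('s, 'a) gsp \<Rightarrow> 'a \<Rightarrow> bool" where
  "maximal_compatible P a \<longleftrightarrow>
     (\<forall>G'\<in>guards P. tgts P a \<inter> G' \<noteq> {} \<longrightarrow>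
        tgts P a \<subseteq> G' \<and>
        (\<forall>s\<in>guard_of P a.
           recv_state P a s \<in> G' \<or>
           (\<exists>r\<in>states P. (\<forall>i\<in>{1..arity P a}. weaker P r (tgt P a i)) \<and>
                         unguarded_path P (recv_state P a s) r)))"

definition internal_compatible :: "('s, 'a) gsp \<Rightarrow> 'a \<Rightarrow> bool" where
  "internal_compatible P a \<longleftrightarrow>
     (let s = src P a 1; s' = tgt P a 1;
          G'' = guard_of P a \<union> {r \<in> states P. weaker P r s'}
      in \<forall>G'\<in>guards P. \<forall>t\<in>guard_of P a.
           s \<notin> G' \<and> s' \<in> G' \<longrightarrow>
           (\<exists>t'\<in>states P. weaker P t' s' \<and> guarded_path P G'' t t'))"

definition guard_compatible :: "('s, 'a) gsp \<Rightarrow> 'a \<Rightarrow> bool" where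
  "guard_compatible P a \<longleftrightarrow>
     (if maximal P a then maximal_compatible P a
      else sender_compatible P a \<or> (internal P a \<and> internal_compatible P a))"

definition well_behaved :: "('s, 'a) gsp \<Rightarrow> bool" where
  "well_behaved P \<longleftrightarrow> (\<forall>a\<in>global_actions P. guard_compatible P a)"


section \<open>Well-structured transition systems\<close>

definition wqo_on :: "'q set \<Rightarrow> ('q \<Rightarrow> 'q \<Rightarrow> bool) \<Rightarrow> bool" where
  "wqo_on Q le \<longleftrightarrow>
     reflp_on Q le \<and> transp_on Q le \<and>
     (\<forall>f :: nat \<Rightarrow> 'q. range f \<subseteq> Q \<longrightarrow> (\<exists>i j. i < j \<and> le (f i) (f j)))"

definition compatible :: "'q set \<Rightarrow> ('q \<Rightarrow> 'q \<Rightarrow> bool) \<Rightarrow> ('q \<Rightarrow> 'q \<Rightarrow> bool) \<Rightarrow> bool" where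
  "compatible Q R le \<longleftrightarrow>
     (\<forall>q\<in>Q. \<forall>p\<in>Q. \<forall>q'\<in>Q. le q p \<and> R q q' \<longrightarrow> (\<exists>p'\<in>Q. le q' p' \<and> R\<^sup>*\<^sup>* p p'))"

definition wsts :: "'q set \<Rightarrow> ('q \<Rightarrow> 'q \<Rightarrow> bool) \<Rightarrow> ('q \<Rightarrow> 'q \<Rightarrow> bool) \<Rightarrow> bool" where
  "wsts Q R le \<longleftrightarrow>
     (\<forall>q q'. R q q' \<longrightarrow> q \<in> Q \<and> q' \<in> Q) \<and> wqo_on Q le \<and> compatible Q R le"

definition up :: "'q set \<Rightarrow> ('q \<Rightarrow> 'q \<Rightarrow> bool) \<Rightarrow> 'q set \<Rightarrow> 'q set" where
  "up Q le U = {p \<in> Q. \<exists>q\<in>U. le q p}"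

definition up_closed :: "'q set \<Rightarrow> ('q \<Rightarrow> 'q \<Rightarrow> bool) \<Rightarrow> 'q set \<Rightarrow> bool" where
  "up_closed Q le U \<longleftrightarrow> U \<subseteq> Q \<and> up Q le U = U"

definition finite_basis :: "'q set \<Rightarrow> ('q \<Rightarrow> 'q \<Rightarrow> bool) \<Rightarrow> 'q set \<Rightarrow> 'q set \<Rightarrow> bool" where
  "finite_basis Q le B U \<longleftrightarrow> finite B \<and> B \<subseteq> U \<and> up Q le B = U"

definition pred_set :: "'q set \<Rightarrow> ('q \<Rightarrow> 'q \<Rightarrow> bool) \<Rightarrow> 'q set \<Rightarrow> 'q set" where
  "pred_set Q R U = {q \<in> Q. \<exists>q'\<in>U. R q q'}"


section \<open>Computability\<close>

text \<open>
  Kleene's partial recursive functions; \<open>None\<close> stands for divergence (or a missing argument).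
\<close>

datatype recf = Zero | Succ | Proj nat | Comp recf "recf list" | PRec recf recf | Mu recf

fun rec_eval :: "recf \<Rightarrow> nat list \<Rightarrow> nat option" where
  "rec_eval Zero xs = Some 0"
| "rec_eval Succ xs = (case xs of [] \<Rightarrow> None | x # _ \<Rightarrow> Some (Suc x))"
| "rec_eval (Proj i) xs = (if i < length xs then Some (xs ! i) else None)"
| "rec_eval (Comp f gs) xs =
     (case those (map (\<lambda>g. rec_eval g xs) gs) of None \<Rightarrow> None | Some ys \<Rightarrow> rec_eval f ys)"
| "rec_eval (PRec g h) xs =
     (case xs of
        [] \<Rightarrow> None
      | n # ys \<Rightarrow>
          rec_nat (rec_eval g ys)
            (\<lambda>k r. case r of None \<Rightarrow> None | Some y \<Rightarrow> rec_eval h (k # y # ys)) n)"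
| "rec_eval (Mu f) xs =
     (if \<exists>n. rec_eval f (n # xs) = Some 0 \<and> (\<forall>k<n. rec_eval f (k # xs) \<noteq> None)
      then Some (LEAST n. rec_eval f (n # xs) = Some 0) else None)"

text \<open>
  The code of a finite set of states is the number whose binary digits mark the codes of its
  elements. For a transitive compatibility (\<open>R\<^sup>*\<^sup>*\<close> on the right-hand side of \<open>compatible\<close>), the set
  \<open>pred_set Q R U\<close> of one-step predecessors of an upwards-closed set \<open>U\<close> need not be upwards
  closed, so that it may have no finite basis at all. A basis of it is therefore a finite set of
  predecessors whose upward closure is the upward closure of \<open>pred_set Q R U\<close>. If
  \<open>pred_set Q R U\<close> is upwards closed, this says exactly \<open>finite_basis Q le B' (pred_set Q R U)\<close>.
\<close>

definition effective_pred ::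
  "('q \<Rightarrow> nat) \<Rightarrow> 'q set \<Rightarrow> ('q \<Rightarrow> 'q \<Rightarrow> bool) \<Rightarrow> ('q \<Rightarrow> 'q \<Rightarrow> bool) \<Rightarrow> bool" where
  "effective_pred code Q R le \<longleftrightarrow>
     (\<exists>f. \<forall>U B. up_closed Q le U \<and> finite_basis Q le B U \<longrightarrow>
        (\<exists>B'. B' \<subseteq> pred_set Q R U \<and> finite_basis Q le B' (up Q le (pred_set Q R U)) \<and>
              rec_eval f [set_encode (code ` B)] = Some (set_encode (code ` B'))))"

text \<open>A global state is coded by the list of its values along an enumeration \<open>ss\<close> of the local states.\<close>

definition config_code :: "'s list \<Rightarrow> ('s \<Rightarrow> nat) \<Rightarrow> nat" where
  "config_code ss q = list_encode (map q ss)"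

end

theory Submission
  imports Defs
begin

text \<open>
  Compatibility. A step from \<open>q\<close> to \<open>q'\<close> is imitated in a larger state \<open>p\<close> by the same action. Only the
  processes that \<open>p\<close> has in addition can violate a guard that \<open>q'\<close> satisfies; well-behavedness provides
  each of them with a path of internal transitions to a state satisfying all these guards, and these
  processes walk along their paths one after the other. That the order is a well-quasi-order is Dickson's
  lemma together with the pigeonhole principle for the set of satisfied guards.

  Computing predecessors. Let \<open>n\<close> bound all entries of a basis of \<open>U\<close> and let \<open>k\<close> be larger than all
  arities. Replacing each entry of a predecessor \<open>q\<close> of \<open>U\<close> by its minimum with \<open>n + k\<close> does not change
  the support and keeps an entry above \<open>n\<close> wherever the target has lost processes, so the truncation
  is again a predecessor of \<open>U\<close>. Hence the predecessors with entries at most \<open>n + k\<close> are a basis, and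
  they are listed by a bounded search. The code of a basis of \<open>U\<close> is itself a suitable bound \<open>n\<close>.
\<close>

section \<open>Dickson's lemma\<close>

text \<open>Every tail of \<open>f\<close> attains its minimum. Stepping each time to a later index
  that is minimal on its own tail yields values that never decrease.\<close>

lemma nat_incseq_subseq:
  fixes f :: "nat \<Rightarrow> nat"
  shows "\<exists>h :: nat \<Rightarrow> nat. strict_mono h \<and> (\<forall>i j. i \<le> j \<longrightarrow> f (h i) \<le> f (h j))"
proof -
  have least: "\<exists>x\<ge>n. \<forall>m\<ge>x. f x \<le> f m" for n
  proof -
    obtain x where "n \<le> x" "\<And>m. n \<le> m \<Longrightarrow> f x \<le> f m"
      using ex_has_least_nat[of "\<lambda>i. n \<le> i" n f] by auto
    then have "\<forall>m\<ge>x. f x \<le> f m" using order_trans by blast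
    with \<open>n \<le> x\<close> show ?thesis by blast
  qed
  have "\<exists>h. \<forall>n. (\<forall>m\<ge>h n. f (h n) \<le> f m) \<and> h n < h (Suc n)"
  proof (rule dependent_nat_choice)
    show "\<exists>x. \<forall>m\<ge>x. f x \<le> f m" using least[of 0] by blast
    show "\<exists>y. (\<forall>m\<ge>y. f y \<le> f m) \<and> x < y" for x using least[of "Suc x"] by (auto simp: Suc_le_eq)
  qed
  then obtain h where h: "\<forall>n. (\<forall>m\<ge>h n. f (h n) \<le> f m) \<and> h n < h (Suc n)" ..
  then have "strict_mono h" by (simp add: strict_mono_Suc_iff)
  moreover have "f (h i) \<le> f (h j)" if "i \<le> j" for i j
    using h strict_mono_less_eq[OF \<open>strict_mono h\<close>] that by simp
  ultimately show ?thesis by (intro exI[of _ h]) simp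
qed

text \<open>One coordinate at a time: thinning a subsequence keeps the coordinates treated before
  monotone.\<close>

lemma dickson:
  fixes f :: "nat \<Rightarrow> 'b \<Rightarrow> nat"
  assumes "finite X"
  shows "\<exists>g :: nat \<Rightarrow> nat. strict_mono g \<and> (\<forall>s\<in>X. \<forall>i j. i \<le> j \<longrightarrow> f (g i) s \<le> f (g j) s)"
  using assms
proof (induction X)
  case empty
  then show ?case by (intro exI[of _ id]) (simp add: strict_mono_def)
next
  case (insert x X)
  then obtain g :: "nat \<Rightarrow> nat"
    where g: "strict_mono g" "\<forall>s\<in>X. \<forall>i j. i \<le> j \<longrightarrow> f (g i) s \<le> f (g j) s" by auto
  obtain h :: "nat \<Rightarrow> nat" where h: "strict_mono h" "\<forall>i j. i \<le> j \<longrightarrow> f (g (h i)) x \<le> f (g (h j)) x"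
    using nat_incseq_subseq[of "\<lambda>i. f (g i) x"] by auto
  have "strict_mono (g \<circ> h)" using g(1) h(1) by (simp add: strict_mono_def)
  moreover have "\<forall>s\<in>insert x X. \<forall>i j. i \<le> j \<longrightarrow> f ((g \<circ> h) i) s \<le> f ((g \<circ> h) j) s"
    using g(2) h(2) strict_mono_less_eq[OF h(1)] by simp
  ultimately show ?case by (intro exI[of _ "g \<circ> h"] conjI)
qed

section \<open>Processes\<close>

locale gsp =
  fixes P :: "('s, 'a) gsp"
  assumes proc: "gsp_process P"
begin

lemma finite_states [simp]: "finite (states P)"
  and finite_actions [simp]: "finite (global_actions P)"
  using proc by (auto simp: gsp_process_def)

lemma trans_relD:
  assumes "(s, l, G, s') \<in> trans_rel P"
  shows "s \<in> states P" "s' \<in> states P" "G \<subseteq> states P" "l \<in> local_actions P" "base l \<in> global_actions P"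
proof -
  have "(s, l, G, s') \<in> states P \<times> local_actions P \<times> Pow (states P) \<times> states P"
    using assms proc by (auto simp add: gsp_process_def)
  then show "s \<in> states P" "s' \<in> states P" "G \<subseteq> states P" "l \<in> local_actions P" "base l \<in> global_actions P"
    by (auto simp: local_actions_def)
qed

lemma finite_guards [simp]: "finite (guards P)"
  by (rule finite_subset[of _ "Pow (states P)"]) (auto simp: guards_def dest: trans_relD)

lemma guard_of_eq:
  assumes "(s, l, G, s') \<in> trans_rel P" "base l = a"
  shows "guard_of P a = G"
proof -
  have "a \<in> global_actions P" using trans_relD(5)[OF assms(1)] assms(2) by simp
  then have "\<exists>G. \<forall>s l H s'. (s, l, H, s') \<in> trans_rel P \<and> base l = a \<longrightarrow> H = G"
    using proc by (simp add: gsp_process_def)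
  then obtain G0 where "\<forall>s l H s'. (s, l, H, s') \<in> trans_rel P \<and> base l = a \<longrightarrow> H = G0" ..
  note G0 = this[rule_format, OF conjI]
  show ?thesis unfolding guard_of_def
  proof (rule the_equality)
    show "\<exists>s l s'. (s, l, G, s') \<in> trans_rel P \<and> base l = a" using assms by blast
    show "H = G" if "\<exists>s l s'. (s, l, H, s') \<in> trans_rel P \<and> base l = a" for H
      using that by (elim exE conjE) (simp add: G0[OF assms] G0)
  qed
qed

lemma send_eq:
  assumes "(s, Send a i, G, s') \<in> trans_rel P"
  shows "src P a i = s" "tgt P a i = s'" "guard_of P a = G" "i \<in> {1..arity P a}" "a \<in> global_actions P"
proof -
  show a: "a \<in> global_actions P" using trans_relD(5)[OF assms] by simp
  show i: "i \<in> {1..arity P a}" using trans_relD(4)[OF assms] by (auto simp: local_actions_def)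
  have "\<exists>!(s, G, s'). (s, Send a i, G, s') \<in> trans_rel P"
    using a i proc by (simp add: gsp_process_def)
  then have "(t, H, t') = (s, G, s')" if "(t, Send a i, H, t') \<in> trans_rel P" for t H t'
    by (rule ex1E) (metis (mono_tags, lifting) assms case_prodI that)
  then have u: "t = s \<and> H = G \<and> t' = s'" if "(t, Send a i, H, t') \<in> trans_rel P" for t H t'
    using that by simp
  show "src P a i = s" unfolding src_def
    by (rule the_equality) (auto dest: u intro: assms)
  show "tgt P a i = s'" unfolding tgt_def
    by (rule the_equality) (auto dest: u intro: assms)
  show "guard_of P a = G" by (rule guard_of_eq[OF assms]) simp
qed

lemma send_trans:
  assumes "a \<in> global_actions P" "i \<in> {1..arity P a}"
  shows "(src P a i, Send a i, guard_of P a, tgt P a i) \<in> trans_rel P"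
proof -
  have "\<exists>!(s, G, s'). (s, Send a i, G, s') \<in> trans_rel P"
    using assms proc by (simp add: gsp_process_def)
  then obtain s G s' where "(s, Send a i, G, s') \<in> trans_rel P" by auto
  then show ?thesis using send_eq by metis
qed

lemma src_states: "a \<in> global_actions P \<Longrightarrow> i \<in> {1..arity P a} \<Longrightarrow> src P a i \<in> states P"
  and tgt_states: "a \<in> global_actions P \<Longrightarrow> i \<in> {1..arity P a} \<Longrightarrow> tgt P a i \<in> states P"
  by (auto dest: send_trans trans_relD(1,2))

lemma arity_pos: "a \<in> global_actions P \<Longrightarrow> 1 \<le> arity P a"
  using proc by (simp add: gsp_process_def)

text \<open>A positive arity provides a transition carrying this guard. Hence
  \<open>config_le\<close> also controls whether the guard of an action is satisfied.\<close>

lemma guard_of_guards: "a \<in> global_actions P \<Longrightarrow> guard_of P a \<in> guards P"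
  using send_trans[of a 1] arity_pos[of a] unfolding guards_def by auto

lemma recv_state_states:
  assumes "a \<in> global_actions P" "s \<in> states P"
  shows "recv_state P a s \<in> states P"
proof -
  have "\<exists>!s'. \<exists>G. (s, Recv a, G, s') \<in> trans_rel P"
    using assms proc by (simp add: gsp_process_def)
  from theI'[OF this] show ?thesis unfolding recv_state_def using trans_relD by blast
qed

section \<open>Global steps\<close>

text \<open>The index sets that the kind of the action admits, before counting the available
  processes.\<close>

definition senders :: "'a \<Rightarrow> nat set set" where
  "senders a = {I. I \<subseteq> {1..arity P a} \<and> (if maximal P a then I \<noteq> {} else I = {1..arity P a})}"

lemma finite_senders [simp]: "finite (senders a)"
  by (rule finite_subset[of _ "Pow {1..arity P a}"]) (auto simp: senders_def)

lemma senders_nonempty: "a \<in> global_actions P \<Longrightarrow> I \<in> senders a \<Longrightarrow> I \<noteq> {}"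
  using arity_pos[of a] by (auto simp: senders_def split: if_splits)

text \<open>For a sender action, the equation on \<open>src_vec\<close> forces \<open>q t \<ge> src_vec P a {1..arity P a} t\<close>,
  so both kinds of actions have the same form.\<close>

lemma step_by_iff:
  "step_by P a q q' \<longleftrightarrow> q \<in> configs P \<and> supp q \<subseteq> guard_of P a \<and>
     (\<exists>I\<in>senders a. (\<forall>t\<in>states P. src_vec P a I t = min (q t) (src_vec P a {1..arity P a} t)) \<and>
        q' = fire P a I q)"
  by (auto simp: step_by_def senders_def min_def)

lemma src_vec_le: "I \<subseteq> {1..arity P a} \<Longrightarrow> src_vec P a I t \<le> arity P a"
  unfolding src_vec_def
  by (rule order_trans[OF card_mono[of "{1..arity P a}"]]) auto

lemma tgt_vec_mono: "I \<subseteq> J \<Longrightarrow> finite J \<Longrightarrow> tgt_vec P a I t \<le> tgt_vec P a J t"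
  unfolding tgt_vec_def by (auto intro!: card_mono)

lemma tgt_vec_pos_iff: "finite I \<Longrightarrow> 0 < tgt_vec P a I t \<longleftrightarrow> t \<in> tgt P a ` I"
  by (auto simp: tgt_vec_def card_gt_0_iff)

text \<open>For fixed \<open>a\<close> and \<open>I\<close> the support of the successor only
  depends on which states hold more processes than send from them; truncation will preserve
  this.\<close>

lemma fire_pos_iff:
  assumes "finite I"
  shows "0 < fire P a I q t \<longleftrightarrow>
    (\<exists>s\<in>states P. recv_state P a s = t \<and> src_vec P a I s < q s) \<or> t \<in> tgt P a ` I"
proof -
  have "0 < recv_map P a (\<lambda>s. q s - src_vec P a I s) t \<longleftrightarrow>
    (\<exists>s\<in>states P. recv_state P a s = t \<and> src_vec P a I s < q s)"
    unfolding recv_map_def by (subst zero_less_iff_neq_zero, subst sum_eq_0_iff) auto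
  then show ?thesis using tgt_vec_pos_iff[OF assms, of a t] by (auto simp: fire_def)
qed

lemma supp_fire_subset: "finite I \<Longrightarrow> q \<in> configs P \<Longrightarrow> supp (fire P a I q) \<subseteq> recv_state P a ` supp q \<union> tgt P a ` I"
  by (auto simp: supp_def fire_pos_iff)

lemma fire_configs:
  assumes "a \<in> global_actions P" "I \<subseteq> {1..arity P a}"
  shows "fire P a I q \<in> configs P"
proof -
  have "finite I" using assms(2) by (rule finite_subset) simp
  then have "t \<in> states P" if "0 < fire P a I q t" for t
    using that recv_state_states[OF assms(1)] tgt_states[OF assms(1)] assms(2)
    unfolding fire_pos_iff[OF \<open>finite I\<close>] by blast
  then show ?thesis unfolding configs_def by blast
qed

lemma step_configs: "step P q q' \<Longrightarrow> q \<in> configs P \<and> q' \<in> configs P"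
  unfolding step_def step_by_iff senders_def using fire_configs by blast

lemma supp_configs: "q \<in> configs P \<Longrightarrow> supp q \<subseteq> states P"
  by (auto simp: configs_def supp_def)

text \<open>The moving process is kept apart from the others, \<open>x\<close>, which an internal
  action leaves where they are.\<close>

lemma step_internal:
  assumes "internal_trans P G s s'" "x \<in> configs P" "supp x \<subseteq> G" "s \<in> G"
  shows "step P (\<lambda>t. x t + of_bool (t = s)) (\<lambda>t. x t + of_bool (t = s'))"
proof -
  from assms(1) obtain a where a: "a \<in> global_actions P" "internal P a" and
    tr: "(s, Send a 1, G, s') \<in> trans_rel P" by (auto simp: internal_trans_def)
  have e: "arity P a = 1" "\<not> maximal P a" "\<And>s. s \<in> states P \<Longrightarrow> recv_state P a s = s"
    using a by (auto simp: internal_def)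
  note se = send_eq[OF tr] and st = trans_relD[OF tr]
  have sv: "src_vec P a {Suc 0} t = of_bool (t = s)" for t
  proof -
    have "{i \<in> {Suc 0}. src P a i = t} = (if t = s then {1} else {})"
      using se(1) by auto
    then show ?thesis by (simp add: src_vec_def)
  qed
  have tv: "tgt_vec P a {Suc 0} t = of_bool (t = s')" for t
  proof -
    have "{i \<in> {Suc 0}. tgt P a i = t} = (if t = s' then {1} else {})"
      using se(2) by auto
    then show ?thesis by (simp add: tgt_vec_def)
  qed
  have x0: "x t = 0" if "t \<notin> states P" for t using that assms(2) by (auto simp: configs_def)
  have "fire P a {1..1} (\<lambda>t. x t + of_bool (t = s)) t = x t + of_bool (t = s')" for t
  proof -
    \<comment> \<open>Outside \<open>states P\<close> the fibre is empty, and \<open>x0\<close>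
      gives the matching value 0.\<close>
    have "{s \<in> states P. recv_state P a s = t} = (if t \<in> states P then {t} else {})"
      using e(3) by auto
    then show ?thesis using x0[of t] by (simp add: fire_def recv_map_def sv tv)
  qed
  then have "fire P a {1..1} (\<lambda>t. x t + of_bool (t = s)) = (\<lambda>t. x t + of_bool (t = s'))" by blast
  then have "step_by P a (\<lambda>t. x t + of_bool (t = s)) (\<lambda>t. x t + of_bool (t = s'))"
    using e assms se(3) st x0 sv by (auto simp: step_by_def configs_def supp_def)
  then show ?thesis using a by (auto simp: step_def)
qed

section \<open>Compatibility\<close>

text \<open>The resting processes lie in \<open>H\<close>, hence in the guard of every transition of
  the path; the walking one lies there because \<open>guarded_path\<close> demands it of each
  source.\<close>

lemma guarded_path_steps:
  assumes "guarded_path P H s s'" "x \<in> configs P" "supp x \<subseteq> H"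
  shows "(step P)\<^sup>*\<^sup>* (\<lambda>t. x t + of_bool (t = s)) (\<lambda>t. x t + of_bool (t = s'))"
  using assms(1) unfolding guarded_path_def
proof (induction rule: rtranclp_induct)
  case base
  then show ?case by simp
next
  case (step u v)
  then obtain G where "H \<subseteq> G" "u \<in> G" "internal_trans P G u v" by blast
  then have "step P (\<lambda>t. x t + of_bool (t = u)) (\<lambda>t. x t + of_bool (t = v))"
    using assms by (intro step_internal[of G]) auto
  with step.IH show ?case by (metis rtranclp.rtrancl_into_rtrancl)
qed

text \<open>The processes outside \<open>W\<close> are moved into \<open>W\<close> one by one; this does not affect \<open>q \<le> p\<close>,
  because \<open>q\<close> vanishes outside \<open>W\<close>.\<close>

lemma move_into:
  assumes "p \<in> configs P" "supp p \<subseteq> H" "\<And>t. q t \<le> p t" "supp q \<subseteq> W" "W \<subseteq> states P"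
    and "\<And>t. t \<in> supp p \<Longrightarrow> t \<notin> W \<Longrightarrow> \<exists>r\<in>W \<inter> H. guarded_path P H t r"
  shows "\<exists>p'. (step P)\<^sup>*\<^sup>* p p' \<and> p' \<in> configs P \<and> (\<forall>t. q t \<le> p' t) \<and> supp p' \<subseteq> W"
  using assms
\<comment> \<open>The measure counts the processes outside \<open>W\<close>; each round takes one of
  them into \<open>W\<close>.\<close>
proof (induction "\<Sum>t\<in>states P - W. p t" arbitrary: p rule: less_induct)
  case less
  show ?case
  proof (cases "supp p \<subseteq> W")
    case True
    then show ?thesis using less.prems by blast
  next
    case False
    then obtain t where t: "t \<in> supp p" "t \<notin> W" by blast
    from less.prems(6)[OF t] obtain r where r: "r \<in> W" "r \<in> H" "guarded_path P H t r" by blast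
    define x where "x = (\<lambda>u. p u - of_bool (u = t))"
    define p1 where "p1 = (\<lambda>u. x u + of_bool (u = r))"
    have p: "p = (\<lambda>u. x u + of_bool (u = t))" using t by (auto simp: x_def supp_def)
    have ts: "t \<in> states P" using t supp_configs[OF less.prems(1)] by blast
    have xc: "x \<in> configs P" using less.prems(1) by (auto simp: x_def configs_def)
    have xH: "supp x \<subseteq> H" using less.prems(2) by (force simp: x_def supp_def)
    have steps: "(step P)\<^sup>*\<^sup>* p p1"
      using guarded_path_steps[OF r(3) xc xH] unfolding p1_def p by simp
    have p1c: "p1 \<in> configs P" using xc r less.prems(5) by (auto simp: p1_def configs_def)
    \<comment> \<open>The support grows at most by \<open>r\<close>, which lies in \<open>W\<close>
      and in \<open>H\<close>, so the bound by \<open>H\<close> and the supply of paths pass on to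
      \<open>p1\<close>.\<close>
    have p1s: "supp p1 \<subseteq> insert r (supp p)" by (auto simp: p1_def x_def supp_def split: if_splits)
    have q: "q u \<le> p1 u" for u
    proof (cases "u = t")
      case True
      then have "q u = 0" using t less.prems(4) by (auto simp: supp_def)
      then show ?thesis by simp
    next
      case False
      then show ?thesis using less.prems(3)[of u] by (simp add: p1_def x_def)
    qed
    have "(\<Sum>u\<in>states P - W. p1 u) < (\<Sum>u\<in>states P - W. p u)"
    proof (rule sum_strict_mono_ex1)
      show "\<forall>u\<in>states P - W. p1 u \<le> p u" using r by (auto simp: p1_def x_def)
      show "\<exists>u\<in>states P - W. p1 u < p u"
        using t ts r by (intro bexI[of _ t]) (auto simp: p1_def x_def supp_def)
    qed simp
    from less.hyps[OF this p1c _ q less.prems(4,5)] p1s less.prems(2,6) r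
    obtain p' where "(step P)\<^sup>*\<^sup>* p1 p'" "p' \<in> configs P" "\<forall>t. q t \<le> p' t" "supp p' \<subseteq> W"
      by blast
    then show ?thesis using steps by (meson rtranclp_trans)
  qed
qed

section \<open>Restoring the order after imitating a step\<close>

lemma config_leD:
  assumes "config_le P q p" "q \<in> configs P"
  shows "q s \<le> p s"
  using assms by (cases "s \<in> states P") (auto simp: config_le_def configs_def)

text \<open>Within \<open>states P\<close>, the intersection of all guards that include
  \<open>X\<close>. When \<open>X\<close> is the support of a state, adding processes in the hull
  changes none of the guards it satisfies.\<close>

definition hull :: "'s set \<Rightarrow> 's set" where
  "hull X = {t \<in> states P. \<forall>G\<in>guards P. X \<subseteq> G \<longrightarrow> t \<in> G}"

text \<open>The processes are moved into the hull of \<open>supp q\<close>. A support caught between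
  \<open>supp q\<close> and its hull is included in exactly the guards that include
  \<open>supp q\<close>, which is the second half of \<open>config_le\<close>.\<close>

lemma move_above:
  assumes "p \<in> configs P" "supp p \<subseteq> H" "q \<in> configs P" "\<And>t. q t \<le> p t"
    and "\<And>t. t \<in> supp p \<Longrightarrow> t \<notin> hull (supp q) \<Longrightarrow> \<exists>r\<in>hull (supp q) \<inter> H. guarded_path P H t r"
  shows "\<exists>p'\<in>configs P. config_le P q p' \<and> (step P)\<^sup>*\<^sup>* p p'"
proof -
  have "supp q \<subseteq> hull (supp q)" "hull (supp q) \<subseteq> states P"
    using supp_configs[OF assms(3)] by (auto simp: hull_def)
  from move_into[OF assms(1,2,4) this assms(5)]
  obtain p' where p': "(step P)\<^sup>*\<^sup>* p p'" "p' \<in> configs P" "\<forall>t. q t \<le> p' t" "supp p' \<subseteq> hull (supp q)"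
    by blast
  have "supp q \<subseteq> supp p'"
    using p'(3) by (auto simp: supp_def intro: less_le_trans)
  with p' have "config_le P q p'" by (auto simp: config_le_def hull_def)
  with p' show ?thesis by blast
qed

text \<open>A larger state may supply more senders of a maximal action. For each source state
  separately, the senders in \<open>I\<close> are enlarged to the required number; for a sender
  action \<open>I\<close> is already everything.\<close>

lemma extend_senders:
  assumes "I \<in> senders a"
    and I: "\<And>t. t \<in> states P \<Longrightarrow> src_vec P a I t = min (q t) (src_vec P a {1..arity P a} t)"
    and "\<And>t. q t \<le> p t" "a \<in> global_actions P"
  obtains J where "J \<in> senders a" "I \<subseteq> J"
    "\<And>t. t \<in> states P \<Longrightarrow> src_vec P a J t = min (p t) (src_vec P a {1..arity P a} t)"
proof -
  let ?K = "{1..arity P a}"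
  have IK: "I \<subseteq> ?K" using assms(1) by (auto simp: senders_def)
  have "\<exists>X. {i \<in> I. src P a i = t} \<subseteq> X \<and> X \<subseteq> {i \<in> ?K. src P a i = t} \<and>
      card X = min (p t) (src_vec P a ?K t)" if "t \<in> states P" for t
  proof (rule exists_subset_between)
    show "card {i \<in> I. src P a i = t} \<le> min (p t) (src_vec P a ?K t)"
      using I[OF that] assms(3)[of t] unfolding src_vec_def by simp
    show "min (p t) (src_vec P a ?K t) \<le> card {i \<in> ?K. src P a i = t}"
      unfolding src_vec_def by simp
  qed (use IK in auto)
  then have "\<forall>t\<in>states P. \<exists>X. {i \<in> I. src P a i = t} \<subseteq> X \<and> X \<subseteq> {i \<in> ?K. src P a i = t} \<and>
      card X = min (p t) (src_vec P a ?K t)" by blast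
  from bchoice[OF this] obtain X where X: "\<And>t. t \<in> states P \<Longrightarrow> {i \<in> I. src P a i = t} \<subseteq> X t"
    "\<And>t. t \<in> states P \<Longrightarrow> X t \<subseteq> {i \<in> ?K. src P a i = t}"
    "\<And>t. t \<in> states P \<Longrightarrow> card (X t) = min (p t) (src_vec P a ?K t)"
    by auto
  \<comment> \<open>The choices for the source states are glued: an index belongs to
    \<open>J\<close> iff it was chosen for its own source.\<close>
  define J where "J = {i \<in> ?K. i \<in> X (src P a i)}"
  have IJ: "I \<subseteq> J"
    using IK X(1)[OF src_states[OF assms(4)]] by (auto simp: J_def subset_iff)
  moreover have "J \<in> senders a"
    using IJ assms(1) by (auto simp: senders_def J_def split: if_splits)
  moreover have "src_vec P a J t = min (p t) (src_vec P a ?K t)" if "t \<in> states P" for t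
  proof -
    have "{i \<in> J. src P a i = t} = X t"
      using X(2)[OF that] by (auto simp: J_def)
    then show ?thesis using X(3)[OF that] by (simp add: src_vec_def)
  qed
  ultimately show ?thesis using that by blast
qed

text \<open>The order keeps the guard of \<open>a\<close> satisfied, so \<open>p\<close> can perform
  the same action with more senders. The result dominates \<open>q'\<close> numerically; the guards
  are repaired afterwards.\<close>

lemma fire_larger:
  assumes "step_by P a q q'" "a \<in> global_actions P" "config_le P q p" "p \<in> configs P"
  shows "\<exists>I J. I \<noteq> {} \<and> I \<subseteq> J \<and> J \<subseteq> {1..arity P a} \<and> q' = fire P a I q \<and>
    step_by P a p (fire P a J p) \<and> (\<forall>t. q' t \<le> fire P a J p t) \<and>
    (\<not> maximal P a \<longrightarrow> I = {1..arity P a})"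
proof -
  let ?K = "{1..arity P a}"
  from assms(1) obtain I where I: "q \<in> configs P" "supp q \<subseteq> guard_of P a" "I \<in> senders a"
    "\<And>t. t \<in> states P \<Longrightarrow> src_vec P a I t = min (q t) (src_vec P a ?K t)" "q' = fire P a I q"
    unfolding step_by_iff by blast
  have le: "\<And>t. q t \<le> p t" using config_leD[OF assms(3) I(1)] .
  from extend_senders[OF I(3,4) le assms(2)] obtain J where J: "J \<in> senders a" "I \<subseteq> J"
    "\<And>t. t \<in> states P \<Longrightarrow> src_vec P a J t = min (p t) (src_vec P a ?K t)" by blast
  have JK: "J \<subseteq> ?K" using J(1) by (auto simp: senders_def)
  have "supp p \<subseteq> guard_of P a"
    using assms(3) I(2) guard_of_guards[OF assms(2)] by (auto simp: config_le_def)
  then have "step_by P a p (fire P a J p)" using assms(4) J unfolding step_by_iff by blast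
  moreover have "q' t \<le> fire P a J p t" for t
  proof -
    \<comment> \<open>With \<open>v\<close> the full source vector, \<open>min (q s) (v s)\<close>
      processes send, so what stays behind is the truncated difference \<open>q s - v s\<close>,
      which is monotone in \<open>q s\<close>.\<close>
    have "q s - src_vec P a I s \<le> p s - src_vec P a J s" if "s \<in> states P" for s
      using le[of s] I(4)[OF that] J(3)[OF that] by (auto simp: min_def)
    then have "recv_map P a (\<lambda>s. q s - src_vec P a I s) t \<le> recv_map P a (\<lambda>s. p s - src_vec P a J s) t"
      unfolding recv_map_def by (intro sum_mono) auto
    moreover have "tgt_vec P a I t \<le> tgt_vec P a J t"
      using J(2) JK by (intro tgt_vec_mono) (auto dest: finite_subset)
    ultimately show ?thesis by (simp add: I(5) fire_def)
  qed
  moreover have "\<not> maximal P a \<Longrightarrow> I = ?K" using I(3) by (simp add: senders_def)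
  ultimately show ?thesis
    using senders_nonempty[OF assms(2) I(3)] J(2) JK I(5) by blast
qed

section \<open>Compatibility under the two forms of guard-compatibility\<close>

lemma unguarded_path_guarded_path: "unguarded_path P s r \<Longrightarrow> guarded_path P (states P) s r"
  unfolding unguarded_path_def guarded_path_def
proof (erule mono_rtranclp[rule_format, rotated])
  fix u v
  assume uv: "internal_trans P (states P) u v"
  \<comment> \<open>Transitions start in local states, which settles the condition on sources in
    \<open>guarded_path\<close>.\<close>
  then have "u \<in> states P" by (auto simp: internal_trans_def dest: trans_relD)
  with uv show "\<exists>G'. states P \<subseteq> G' \<and> u \<in> G' \<and> internal_trans P G' u v" by blast
qed

text \<open>Targets of \<open>a\<close> never violate a guard that \<open>q'\<close> satisfies, so a
  misplaced process of the imitating state has received. It came from the guard of \<open>a\<close>,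
  and compatibility offers it an unguarded path into the hull.\<close>

lemma compatible_sending:
  assumes "a \<in> global_actions P" "q \<in> configs P" "q' \<in> configs P" "p \<in> configs P"
    and "step_by P a q q'" "config_le P q p"
    and "if maximal P a then maximal_compatible P a else sender_compatible P a"
  shows "\<exists>p'\<in>configs P. config_le P q' p' \<and> (step P)\<^sup>*\<^sup>* p p'"
proof -
  let ?K = "{1..arity P a}"
  obtain I J where IJ: "I \<noteq> {}" "I \<subseteq> J" "J \<subseteq> ?K"
    "q' = fire P a I q" "step_by P a p (fire P a J p)" "\<And>t. q' t \<le> fire P a J p t"
    "\<not> maximal P a \<Longrightarrow> I = ?K" using fire_larger[OF assms(5,1,6,4)] by blast
  let ?p = "fire P a J p"
  have fin: "finite I" "finite J" using IJ(2,3) by (meson finite_atLeastAtMost finite_subset)+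
  have pc: "?p \<in> configs P" by (rule fire_configs[OF assms(1) IJ(3)])
  have tI: "tgt P a ` I \<subseteq> supp q'" unfolding IJ(4) supp_def by (auto simp: fire_pos_iff[OF fin(1)])
  have pG: "supp p \<subseteq> guard_of P a" using IJ(5) by (simp add: step_by_iff)
  have maximal: "tgts P a \<subseteq> G \<and> (\<forall>s\<in>guard_of P a. recv_state P a s \<in> G \<or>
      (\<exists>r\<in>states P. (\<forall>i\<in>?K. weaker P r (tgt P a i)) \<and> unguarded_path P (recv_state P a s) r))"
    if "maximal P a" "G \<in> guards P" "tgts P a \<inter> G \<noteq> {}" for G
    using assms(7) that by (simp add: maximal_compatible_def)
  have sender: "recv_state P a s \<in> G \<or>
      (\<exists>r\<in>states P. weaker_set P r (tgts P a) \<and> unguarded_path P (recv_state P a s) r)"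
    if "\<not> maximal P a" "G \<in> guards P" "tgts P a \<subseteq> G" "s \<in> guard_of P a" for G s
    using assms(7) that by (simp add: sender_compatible_def)
  \<comment> \<open>A guard including \<open>supp q'\<close> contains all targets of
    \<open>a\<close>: for a sender action they are all occupied in \<open>q'\<close>, for a maximal
    action at least one is and compatibility supplies the others.\<close>
  have tgt_hull: "t \<in> hull (supp q')" if that0: "t \<in> states P"
    "\<And>G. G \<in> guards P \<Longrightarrow> tgts P a \<subseteq> G \<Longrightarrow> tgts P a \<inter> G \<noteq> {} \<Longrightarrow> t \<in> G" for t
  proof -
    have "t \<in> G" if G: "G \<in> guards P" "supp q' \<subseteq> G" for G
    proof -
      note hyp = that0(2)[OF G(1)]
      obtain i where "i \<in> I" using IJ(1) by blast
      then have "tgt P a i \<in> tgts P a \<inter> G" using IJ(2,3) tI G(2) unfolding tgts_def by blast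
      then have ne: "tgts P a \<inter> G \<noteq> {}" by blast
      have "tgts P a \<subseteq> G"
      proof (cases "maximal P a")
        case True
        from maximal[OF this G(1) ne] show ?thesis ..
      next
        case False
        with IJ(7) tI G show ?thesis unfolding tgts_def by blast
      qed
      then show ?thesis using hyp ne by blast
    qed
    with that0(1) show ?thesis by (simp add: hull_def)
  qed
  have "\<exists>r\<in>hull (supp q') \<inter> states P. guarded_path P (states P) t r"
    if t: "t \<in> supp ?p" "t \<notin> hull (supp q')" for t
  proof -
    have ts: "t \<in> states P" using t(1) supp_configs[OF pc] by blast
    from t(2) tgt_hull[OF ts] obtain G where G: "G \<in> guards P" "tgts P a \<subseteq> G" "tgts P a \<inter> G \<noteq> {}" "t \<notin> G"
      by blast
    \<comment> \<open>All targets lie in \<open>G\<close> but \<open>t\<close> does not, so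
      \<open>t\<close> was reached by receiving in a state \<open>s\<close> of the guard.\<close>
    have "t \<notin> tgt P a ` J" using G IJ(3) by (auto simp: tgts_def)
    with t(1) supp_fire_subset[OF fin(2) assms(4), of a] pG
    obtain s where s: "s \<in> guard_of P a" "t = recv_state P a s" by blast
    show ?thesis
    proof (cases "maximal P a")
      case True
      from maximal[OF this G(1,3)] G(4) s obtain r where r: "r \<in> states P" "unguarded_path P t r"
        "\<And>i. i \<in> ?K \<Longrightarrow> weaker P r (tgt P a i)"
        by blast
      have "r \<in> hull (supp q')"
      proof (rule tgt_hull[OF r(1)])
        fix G
        assume "G \<in> guards P" "tgts P a \<inter> G \<noteq> {}"
        then show "r \<in> G" using r(3) unfolding tgts_def weaker_def by blast
      qed
      with r show ?thesis by (meson IntI unguarded_path_guarded_path)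
    next
      case False
      from sender[OF this G(1,2) s(1)] G(4) s(2) obtain r where r: "r \<in> states P" "unguarded_path P t r"
        "weaker_set P r (tgts P a)"
        by blast
      have "r \<in> hull (supp q')"
        by (rule tgt_hull[OF r(1)]) (use r(3) in \<open>simp add: weaker_set_def\<close>)
      with r show ?thesis by (meson IntI unguarded_path_guarded_path)
    qed
  qed
  from move_above[OF pc supp_configs[OF pc] assms(3) IJ(6) this]
  obtain p' where p': "p' \<in> configs P" "config_le P q' p'" "(step P)\<^sup>*\<^sup>* ?p p'" by blast
  moreover have "step P p ?p" using IJ(5) assms(1) by (auto simp: step_def)
  ultimately show ?thesis by (meson converse_rtranclp_into_rtranclp)
qed

text \<open>Receivers stay put, so a misplaced process was already in \<open>p\<close>, violating a
  guard \<open>G\<close> that \<open>q'\<close> satisfies. By the order \<open>q\<close> violated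
  \<open>G\<close> too; only the sender can have removed this violation, by leaving
  \<open>s \<notin> G\<close> for \<open>s' \<in> G\<close>.\<close>

lemma compatible_internal:
  assumes "a \<in> global_actions P" "q \<in> configs P" "q' \<in> configs P" "p \<in> configs P"
    and "step_by P a q q'" "config_le P q p"
    and "internal P a" "internal_compatible P a"
  shows "\<exists>p'\<in>configs P. config_le P q' p' \<and> (step P)\<^sup>*\<^sup>* p p'"
proof -
  have a: "\<not> maximal P a" "arity P a = 1" "\<And>s. s \<in> states P \<Longrightarrow> recv_state P a s = s"
    using assms(7) by (auto simp: internal_def)
  define s where "s = src P a 1"
  define s' where "s' = tgt P a 1"
  \<comment> \<open>This is \<open>G''\<close> of \<open>internal_compatible\<close>: between two
    walks every process stands in the guard of \<open>a\<close> or in a state weaker than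
    \<open>s'\<close>.\<close>
  define H where "H = guard_of P a \<union> {r \<in> states P. weaker P r s'}"
  have ss: "s \<in> states P" "s' \<in> states P"
    unfolding s_def s'_def using src_states tgt_states assms(1) a(2) by auto
  obtain I J where IJ0: "I \<noteq> {}" "I \<subseteq> J" "J \<subseteq> {1..arity P a}" "q' = fire P a I q"
    "step_by P a p (fire P a J p)" "\<And>t. q' t \<le> fire P a J p t"
    "\<not> maximal P a \<Longrightarrow> I = {1..arity P a}" using fire_larger[OF assms(5,1,6,4)] by blast
  have "I = {1}" "J = {1}" using IJ0(2,3,7) a by auto
  note IJ = IJ0(4-6)[unfolded this]
  let ?p = "fire P a {1} p"
  have pc: "?p \<in> configs P" using a(2) by (intro fire_configs[OF assms(1)]) simp
  have s'q': "s' \<in> supp q'" by (auto simp: IJ(1) supp_def s'_def fire_pos_iff)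
  have weaker_hull: "r \<in> hull (supp q')" if "r \<in> states P" "weaker P r s'" for r
    using that s'q' by (auto simp: hull_def weaker_def)
  have pG: "supp p \<subseteq> guard_of P a" using IJ(2) by (simp add: step_by_iff)
  have "supp ?p \<subseteq> recv_state P a ` supp p \<union> {s'}"
    using supp_fire_subset[of "{1}" p a] assms(4) by (simp add: s'_def)
  with a(3) supp_configs[OF assms(4)] have ps: "supp ?p \<subseteq> supp p \<union> {s'}"
    by (fastforce simp: subset_iff)
  have "supp ?p \<subseteq> H" using ps pG ss by (auto simp: H_def weaker_def)
  moreover have "\<exists>r\<in>hull (supp q') \<inter> H. guarded_path P H t r"
    if t: "t \<in> supp ?p" "t \<notin> hull (supp q')" for t
  proof -
    have tp: "t \<in> supp p" using t ps weaker_hull[OF ss(2)] by (auto simp: weaker_def)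
    have "t \<in> states P" using tp supp_configs[OF assms(4)] by blast
    with t(2) obtain G where G: "G \<in> guards P" "supp q' \<subseteq> G" "t \<notin> G" by (auto simp: hull_def)
    have "\<not> supp q \<subseteq> G" using assms(6) G tp by (auto simp: config_le_def)
    then obtain u where u: "u \<in> supp q" "u \<notin> G" by blast
    have us: "u \<in> states P" using u supp_configs[OF assms(2)] by blast
    \<comment> \<open>Were \<open>s\<close> in \<open>G\<close>, the violation at \<open>u\<close>
      would come from a process that neither sends nor moves, and it would persist in
      \<open>q'\<close>.\<close>
    have "s \<notin> G"
    proof
      assume "s \<in> G"
      then have "u \<noteq> s" using u by blast
      then have "src_vec P a {1} u = 0" by (simp add: src_vec_def s_def)
      then have "u \<in> supp q'" using u us a(3) by (auto simp: IJ(1) supp_def fire_pos_iff)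
      then show False using u G by blast
    qed
    moreover have "s' \<in> G" using s'q' G by blast
    ultimately have "\<exists>r\<in>states P. weaker P r s' \<and> guarded_path P H t r"
      using assms(8) G(1) pG tp unfolding internal_compatible_def H_def s_def s'_def Let_def by blast
    then show ?thesis using weaker_hull by (auto simp: H_def)
  qed
  ultimately obtain p' where "p' \<in> configs P" "config_le P q' p'" "(step P)\<^sup>*\<^sup>* ?p p'"
    using move_above[OF pc _ assms(3) IJ(3)] by blast
  moreover have "step P p ?p" using IJ(2) assms(1) by (auto simp: step_def)
  ultimately show ?thesis by (meson converse_rtranclp_into_rtranclp)
qed

lemma compatible_step:
  assumes "well_behaved P"
  shows "compatible (configs P) (step P) (config_le P)"
  unfolding compatible_def
proof (intro ballI impI)
  fix q p q'
  assume c: "q \<in> configs P" "p \<in> configs P" "q' \<in> configs P" "config_le P q p \<and> step P q q'"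
  then obtain a where a: "a \<in> global_actions P" "step_by P a q q'" by (auto simp: step_def)
  have "guard_compatible P a" using assms a by (simp add: well_behaved_def)
  then consider "if maximal P a then maximal_compatible P a else sender_compatible P a"
    | "internal P a" "internal_compatible P a"
    by (auto simp: guard_compatible_def split: if_splits)
  then show "\<exists>p'\<in>configs P. config_le P q' p' \<and> (step P)\<^sup>*\<^sup>* p p'"
    using compatible_sending[OF a(1) c(1,3,2) a(2)] compatible_internal[OF a(1) c(1,3,2) a(2)] c(4)
    by cases blast+
qed

section \<open>Well-quasi-order\<close>

lemma config_le_refl: "config_le P q q"
  by (simp add: config_le_def)

lemma config_le_trans: "config_le P q p \<Longrightarrow> config_le P p r \<Longrightarrow> config_le P q r"
  by (auto simp: config_le_def intro: order_trans)

lemma wqo_config_le: "wqo_on (configs P) (config_le P)"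
  unfolding wqo_on_def
proof (intro conjI allI impI)
  show "reflp_on (configs P) (config_le P)" by (simp add: reflp_on_def config_le_refl)
  show "transp_on (configs P) (config_le P)" unfolding transp_on_def using config_le_trans by blast
  fix f :: "nat \<Rightarrow> 's \<Rightarrow> nat"
  assume "range f \<subseteq> configs P"
  obtain g :: "nat \<Rightarrow> nat"
    where g: "strict_mono g" "\<forall>s\<in>states P. \<forall>i j. i \<le> j \<longrightarrow> f (g i) s \<le> f (g j) s"
    using dickson[OF finite_states, of f] by auto
  \<comment> \<open>The satisfied guards along the monotone subsequence: finitely many values, so
    two indices share one.\<close>
  define h where "h n = {G \<in> guards P. supp (f (g n)) \<subseteq> G}" for n
  have "finite (range h)" by (rule finite_subset[of _ "Pow (guards P)"]) (auto simp: h_def)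
  then have "\<not> inj h" by (auto dest: finite_imageD)
  then obtain i j where "i < j" "h i = h j" using linorder_injI[of h] by blast
  then have "supp (f (g i)) \<subseteq> G \<longleftrightarrow> supp (f (g j)) \<subseteq> G" if "G \<in> guards P" for G
    using that unfolding h_def by blast
  then have "config_le P (f (g i)) (f (g j))"
    using g(2) \<open>i < j\<close> unfolding config_le_def by simp
  moreover have "g i < g j" using \<open>i < j\<close> g(1) by (simp add: strict_mono_less)
  ultimately show "\<exists>i j. i < j \<and> config_le P (f i) (f j)" by blast
qed

lemma wsts_config_le: "well_behaved P \<Longrightarrow> wsts (configs P) (step P) (config_le P)"
  unfolding wsts_def by (auto dest: step_configs simp: wqo_config_le compatible_step)

end

section \<open>Total computable functions\<close>

text \<open>A layer of total functions over \<open>recf\<close>: programs arise from closure rules,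
  and divergence does not have to be tracked.\<close>

definition computable :: "nat \<Rightarrow> (nat list \<Rightarrow> nat) \<Rightarrow> bool" where
  "computable k F \<longleftrightarrow> (\<exists>f. \<forall>xs. length xs = k \<longrightarrow> rec_eval f xs = Some (F xs))"

definition decidable :: "nat \<Rightarrow> (nat list \<Rightarrow> bool) \<Rightarrow> bool" where
  "decidable k R \<longleftrightarrow> computable k (\<lambda>xs. of_bool (R xs))"

lemma computable_cong:
  assumes "\<And>xs. length xs = k \<Longrightarrow> F xs = G xs" "computable k F"
  shows "computable k G"
  using assms unfolding computable_def by metis

lemma decidable_cong:
  assumes "\<And>xs. length xs = k \<Longrightarrow> R xs \<longleftrightarrow> Q xs" "decidable k R"
  shows "decidable k Q"
  using assms(2) unfolding decidable_def by (rule computable_cong[rotated]) (simp add: assms(1))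

lemma computable_nth: "i < k \<Longrightarrow> computable k (\<lambda>xs. xs ! i)"
  unfolding computable_def by (intro exI[of _ "Proj i"]) simp

lemma computable_comp:
  assumes "computable (length Gs) F" "\<And>G. G \<in> set Gs \<Longrightarrow> computable k G"
  shows "computable k (\<lambda>xs. F (map (\<lambda>G. G xs) Gs))"
proof -
  obtain f where f: "\<And>xs. length xs = length Gs \<Longrightarrow> rec_eval f xs = Some (F xs)"
    using assms(1) unfolding computable_def by blast
  from assms(2) have "\<exists>gs. length gs = length Gs \<and>
    (\<forall>xs. length xs = k \<longrightarrow> map (\<lambda>g. rec_eval g xs) gs = map Some (map (\<lambda>G. G xs) Gs))"
  proof (induction Gs)
    case Nil
    then show ?case by simp
  next
    case (Cons G Gs)
    then obtain gs where gs: "length gs = length Gs"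
      "\<forall>xs. length xs = k \<longrightarrow> map (\<lambda>g. rec_eval g xs) gs = map Some (map (\<lambda>G. G xs) Gs)"
      by auto
    obtain g where "\<forall>xs. length xs = k \<longrightarrow> rec_eval g xs = Some (G xs)"
      using Cons.prems[of G] by (auto simp: computable_def)
    with gs show ?case by (intro exI[of _ "g # gs"]) simp
  qed
  then obtain gs where gs: "length gs = length Gs"
    "\<And>xs. length xs = k \<Longrightarrow> map (\<lambda>g. rec_eval g xs) gs = map Some (map (\<lambda>G. G xs) Gs)"
    by blast
  have those: "those (map Some ys) = Some ys" for ys :: "nat list"
    by (induction ys) simp_all
  have "rec_eval (Comp f gs) xs = Some (F (map (\<lambda>G. G xs) Gs))" if "length xs = k" for xs
    using f by (simp only: rec_eval.simps gs(2)[OF that] those option.case length_map)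
  then show ?thesis unfolding computable_def by blast
qed

lemma computable_reindex:
  assumes "computable (length js) F" "set js \<subseteq> {..<k}"
  shows "computable k (\<lambda>xs. F (map (\<lambda>j. xs ! j) js))"
  using computable_comp[of "map (\<lambda>j xs. xs ! j) js" F k] assms
  by (auto simp: comp_def subset_iff intro: computable_nth)

text \<open>Variables bound by recursion or search are put in front of the argument list; functions
  of the older arguments skip them.\<close>

lemma computable_drop:
  assumes "computable k F"
  shows "computable (m + k) (\<lambda>xs. F (drop m xs))"
proof (rule computable_cong[rotated])
  show "computable (m + k) (\<lambda>xs. F (map (\<lambda>j. xs ! j) [m..<m + k]))"
    using assms by (intro computable_reindex) auto
  show "F (map (\<lambda>j. xs ! j) [m..<m + k]) = F (drop m xs)" if "length xs = m + k" for xs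
    using that by (intro arg_cong[of _ _ F] nth_equalityI) auto
qed

lemma computable_tl: "computable k F \<Longrightarrow> computable (Suc k) (\<lambda>xs. F (tl xs))"
  using computable_drop[of k F 1] by (simp add: drop_Suc)

lemma computable_const: "computable k (\<lambda>xs. c)"
proof (induction c)
  case 0
  then show ?case unfolding computable_def by (intro exI[of _ Zero]) simp
next
  case (Suc c)
  have "computable 1 (\<lambda>xs. Suc (xs ! 0))"
    unfolding computable_def by (intro exI[of _ Succ]) (auto simp: length_Suc_conv)
  with Suc computable_comp[of "[\<lambda>xs. c]" "\<lambda>xs. Suc (xs ! 0)" k] show ?case by simp
qed

lemma computable_Suc:
  assumes "computable k F"
  shows "computable k (\<lambda>xs. Suc (F xs))"
proof -
  have "computable 1 (\<lambda>xs. Suc (xs ! 0))"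
    unfolding computable_def by (intro exI[of _ Succ]) (auto simp: length_Suc_conv)
  with assms computable_comp[of "[F]" "\<lambda>xs. Suc (xs ! 0)" k] show ?thesis by simp
qed

text \<open>\<open>PRec\<close> recurses on its first argument, so the number of rounds
  \<open>B xs\<close> is put in front of \<open>xs\<close>. The step receives the round, the value
  so far and then the parameters, hence \<open>drop 2\<close>.\<close>

lemma computable_rec_nat:
  assumes "computable k B" "computable k G"
    and H: "computable (Suc (Suc k)) (\<lambda>ys. H (ys ! 0) (ys ! 1) (drop 2 ys))"
  shows "computable k (\<lambda>xs. rec_nat (G xs) (\<lambda>n r. H n r xs) (B xs))"
proof -
  obtain g where g: "\<And>xs. length xs = k \<Longrightarrow> rec_eval g xs = Some (G xs)"
    using assms(2) unfolding computable_def by blast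
  obtain h where h: "\<And>ys. length ys = Suc (Suc k) \<Longrightarrow> rec_eval h ys = Some (H (ys ! 0) (ys ! 1) (drop 2 ys))"
    using H unfolding computable_def by blast
  let ?F = "\<lambda>xs. rec_nat (G (tl xs)) (\<lambda>n r. H n r (tl xs)) (hd xs)"
  \<comment> \<open>As \<open>g\<close> and \<open>h\<close> are total on these arguments, the
    recursion on options never meets \<open>None\<close>.\<close>
  have "rec_nat (rec_eval g xs) (\<lambda>k r. case r of None \<Rightarrow> None | Some y \<Rightarrow> rec_eval h (k # y # xs)) n
    = Some (rec_nat (G xs) (\<lambda>n r. H n r xs) n)" if "length xs = k" for xs n
    using that by (induction n) (simp_all add: g h)
  then have "rec_eval (PRec g h) xs = Some (?F xs)" if "length xs = Suc k" for xs
    using that by (cases xs) simp_all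
  then have "computable (Suc k) ?F" unfolding computable_def by blast
  moreover have len: "length (B # map (\<lambda>j xs. xs ! j) [0..<k]) = Suc k" by simp
  ultimately have "computable k (\<lambda>xs. ?F (map (\<lambda>G. G xs) (B # map (\<lambda>j xs. xs ! j) [0..<k])))"
    using assms(1) by (intro computable_comp) (auto intro: computable_nth)
  then show ?thesis
  proof (rule computable_cong[rotated])
    fix xs :: "nat list" assume "length xs = k"
    then have "map (\<lambda>G. G xs) (B # map (\<lambda>j xs. xs ! j) [0..<k]) = B xs # xs"
      by (simp add: comp_def map_nth[symmetric]) (use map_nth[of xs] in simp)
    then show "?F (map (\<lambda>G. G xs) (B # map (\<lambda>j xs. xs ! j) [0..<k])) =
      rec_nat (G xs) (\<lambda>n r. H n r xs) (B xs)" by simp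
  qed
qed

section \<open>Arithmetic by primitive recursion\<close>

lemma computable_drop2: "computable k F \<Longrightarrow> computable (Suc (Suc k)) (\<lambda>xs. F (drop 2 xs))"
  using computable_drop[of k F 2] by simp

lemma computable_add:
  assumes "computable k F" "computable k G"
  shows "computable k (\<lambda>xs. F xs + G xs)"
proof -
  have "computable k (\<lambda>xs. rec_nat (G xs) (\<lambda>n r. Suc r) (F xs))"
    by (intro computable_rec_nat assms computable_Suc computable_nth) simp
  moreover have "rec_nat b (\<lambda>n r. Suc r) a = a + b" for a b by (induction a) simp_all
  ultimately show ?thesis by simp
qed

lemma computable_mult:
  assumes "computable k F" "computable k G"
  shows "computable k (\<lambda>xs. F xs * G xs)"
proof -
  have "computable k (\<lambda>xs. rec_nat 0 (\<lambda>n r. r + G xs) (F xs))"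
    by (intro computable_rec_nat assms computable_add computable_nth computable_const computable_drop2) simp
  moreover have "rec_nat 0 (\<lambda>n r. r + b) a = a * b" for a b :: nat by (induction a) simp_all
  ultimately show ?thesis by simp
qed

lemma computable_diff:
  assumes "computable k F" "computable k G"
  shows "computable k (\<lambda>xs. F xs - G xs)"
proof -
  have pred: "computable m (\<lambda>xs. H xs - 1)" if "computable m H" for m H
  proof -
    have "computable m (\<lambda>xs. rec_nat 0 (\<lambda>n r. n) (H xs))"
      by (intro computable_rec_nat that computable_nth computable_const) simp
    moreover have "rec_nat 0 (\<lambda>n r. n) a = a - 1" for a by (cases a) simp_all
    ultimately show ?thesis by simp
  qed
  have "computable k (\<lambda>xs. rec_nat (F xs) (\<lambda>n r. r - 1) (G xs))"
    by (intro computable_rec_nat assms pred computable_nth) simp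
  moreover have "rec_nat a (\<lambda>n r. r - 1) b = a - b" for a b :: nat by (induction b) simp_all
  ultimately show ?thesis by simp
qed

lemma computable_power2:
  assumes "computable k F"
  shows "computable k (\<lambda>xs. 2 ^ F xs)"
proof -
  have "computable k (\<lambda>xs. rec_nat 1 (\<lambda>n r. r + r) (F xs))"
    by (intro computable_rec_nat assms computable_add computable_nth computable_const) simp_all
  moreover have "rec_nat 1 (\<lambda>n r. r + r) a = (2 :: nat) ^ a" for a
    by (induction a) (simp_all add: mult_2)
  ultimately show ?thesis by simp
qed

lemma computable_triangle:
  assumes "computable k F"
  shows "computable k (\<lambda>xs. triangle (F xs))"
proof -
  have "computable k (\<lambda>xs. rec_nat 0 (\<lambda>n r. r + Suc n) (F xs))"
    by (intro computable_rec_nat assms computable_add computable_Suc computable_nth computable_const) simp_all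
  moreover have "rec_nat 0 (\<lambda>n r. r + Suc n) a = triangle a" for a :: nat by (induction a) simp_all
  ultimately show ?thesis by simp
qed

lemma computable_list_encode:
  assumes "\<And>F. F \<in> set Fs \<Longrightarrow> computable k F"
  shows "computable k (\<lambda>xs. list_encode (map (\<lambda>F. F xs) Fs))"
  using assms
proof (induction Fs)
  case Nil
  then show ?case by (simp add: computable_const)
next
  case (Cons F Fs)
  then show ?case
    by (simp add: prod_encode_def computable_Suc computable_add computable_triangle)
qed

lemma computable_sum_finite:
  assumes "finite X" "\<And>i. i \<in> X \<Longrightarrow> computable k (F i)"
  shows "computable k (\<lambda>xs. \<Sum>i\<in>X. F i xs)"
  using assms by (induction X) (simp_all add: computable_const computable_add)

lemma computable_sum_less:
  assumes "computable (Suc k) F" "computable k B"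
  shows "computable k (\<lambda>xs. \<Sum>y<B xs. F (y # xs))"
proof -
  \<comment> \<open>Inside the recursion the arguments are index, accumulated sum and parameters;
    \<open>F\<close> has to skip the sum at position 1.\<close>
  have "computable (Suc (Suc k)) (\<lambda>ys. F (map (\<lambda>j. ys ! j) (0 # [2..<Suc (Suc k)])))"
    by (rule computable_reindex) (use assms(1) in \<open>auto simp del: upt_Suc\<close>)
  then have "computable (Suc (Suc k)) (\<lambda>ys. F (ys ! 0 # drop 2 ys))"
  proof (rule computable_cong[rotated])
    fix ys :: "nat list" assume "length ys = Suc (Suc k)"
    then have "map (\<lambda>j. ys ! j) (0 # [2..<Suc (Suc k)]) = ys ! 0 # drop 2 ys"
      by (intro nth_equalityI) (auto simp: nth_Cons simp del: upt_Suc split: nat.splits)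
    then show "F (map (\<lambda>j. ys ! j) (0 # [2..<Suc (Suc k)])) = F (ys ! 0 # drop 2 ys)" by simp
  qed
  then have "computable k (\<lambda>xs. rec_nat 0 (\<lambda>n r. r + F (n # xs)) (B xs))"
    by (intro computable_rec_nat assms computable_add computable_nth computable_const) simp_all
  moreover have "rec_nat 0 (\<lambda>n r. r + F (n # xs)) a = (\<Sum>y<a. F (y # xs))" for a xs by (induction a) simp_all
  ultimately show ?thesis by simp
qed

section \<open>Decidable predicates and bounded search\<close>

lemma decidable_pos:
  assumes "computable k F"
  shows "decidable k (\<lambda>xs. 0 < F xs)"
proof -
  have "computable k (\<lambda>xs. 1 - (1 - F xs))"
    by (intro computable_diff computable_const assms)
  then show ?thesis unfolding decidable_def
    by (rule computable_cong[rotated]) (simp add: of_bool_def)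
qed

lemma decidable_less:
  assumes "computable k F" "computable k G"
  shows "decidable k (\<lambda>xs. F xs < G xs)"
  using decidable_pos[OF computable_diff[OF assms(2,1)]] by simp

lemma decidable_const: "decidable k (\<lambda>xs. b)"
  unfolding decidable_def by (rule computable_const)

lemma decidable_not:
  assumes "decidable k R"
  shows "decidable k (\<lambda>xs. \<not> R xs)"
proof -
  have "computable k (\<lambda>xs. 1 - of_bool (R xs))"
    using assms unfolding decidable_def by (intro computable_diff computable_const)
  then show ?thesis unfolding decidable_def
    by (rule computable_cong[rotated]) (simp add: of_bool_def)
qed

lemma decidable_conj:
  assumes "decidable k R" "decidable k Q"
  shows "decidable k (\<lambda>xs. R xs \<and> Q xs)"
  using computable_mult[OF assms[unfolded decidable_def]] unfolding decidable_def
  by (rule computable_cong[rotated]) simp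

lemma decidable_disj:
  assumes "decidable k R" "decidable k Q"
  shows "decidable k (\<lambda>xs. R xs \<or> Q xs)"
  using decidable_not[OF decidable_conj[OF decidable_not[OF assms(1)] decidable_not[OF assms(2)]]]
  by simp

lemma decidable_imp:
  assumes "decidable k R" "decidable k Q"
  shows "decidable k (\<lambda>xs. R xs \<longrightarrow> Q xs)"
  using decidable_disj[OF decidable_not[OF assms(1)] assms(2)] by (rule decidable_cong[rotated]) blast

lemma decidable_iff:
  assumes "decidable k R" "decidable k Q"
  shows "decidable k (\<lambda>xs. R xs \<longleftrightarrow> Q xs)"
  using decidable_conj[OF decidable_imp[OF assms] decidable_imp[OF assms(2,1)]]
  by (rule decidable_cong[rotated]) auto

lemma decidable_le:
  assumes "computable k F" "computable k G"
  shows "decidable k (\<lambda>xs. F xs \<le> G xs)"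
  using decidable_not[OF decidable_less[OF assms(2,1)]] by (simp add: not_less)

lemma decidable_eq:
  assumes "computable k F" "computable k G"
  shows "decidable k (\<lambda>xs. F xs = G xs)"
  using decidable_conj[OF decidable_le[OF assms] decidable_le[OF assms(2,1)]]
  by (rule decidable_cong[rotated]) auto

lemma decidable_ball:
  assumes "finite X" "\<And>i. i \<in> X \<Longrightarrow> decidable k (R i)"
  shows "decidable k (\<lambda>xs. \<forall>i\<in>X. R i xs)"
  using assms by (induction X) (simp_all add: decidable_const decidable_conj)

lemma decidable_bex:
  assumes "finite X" "\<And>i. i \<in> X \<Longrightarrow> decidable k (R i)"
  shows "decidable k (\<lambda>xs. \<exists>i\<in>X. R i xs)"
  using assms by (induction X) (simp_all add: decidable_const decidable_disj)

text \<open>The witnesses are counted by a bounded sum.\<close>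

lemma decidable_ex_less:
  assumes "decidable (Suc k) R" "computable k B"
  shows "decidable k (\<lambda>xs. \<exists>y<B xs. R (y # xs))"
proof -
  have "decidable k (\<lambda>xs. 0 < (\<Sum>y<B xs. of_bool (R (y # xs)) :: nat))"
    using assms unfolding decidable_def
    by (intro decidable_pos[unfolded decidable_def] computable_sum_less[of k "\<lambda>xs. of_bool (R xs)"])
  then show ?thesis by (simp only: zero_less_iff_neq_zero sum_eq_0_iff finite_lessThan) (simp add: Bex_def)
qed

lemma decidable_ex_list:
  assumes "decidable (d + k) R" "computable k B"
  shows "decidable k (\<lambda>xs. \<exists>ys. length ys = d \<and> (\<forall>y\<in>set ys. y < B xs) \<and> R (ys @ xs))"
  using assms
proof (induction d arbitrary: k B)
  case 0
  then show ?case by simp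
next
  case (Suc d)
  have "decidable (Suc k) (\<lambda>xs. \<exists>ys. length ys = d \<and> (\<forall>y\<in>set ys. y < B (tl xs)) \<and> R (ys @ xs))"
    using Suc.prems by (intro Suc.IH computable_tl) simp_all
  from decidable_ex_less[OF this Suc.prems(2)] show ?case
  \<comment> \<open>The outer search binds the last entry, because the inner list is prepended to
    \<open>y # xs\<close>; \<open>tl\<close> in the bound removes that entry again.\<close>
  proof (rule decidable_cong[rotated])
    fix xs :: "nat list"
    show "(\<exists>y<B xs. \<exists>ys. length ys = d \<and> (\<forall>z\<in>set ys. z < B (tl (y # xs))) \<and> R (ys @ y # xs)) \<longleftrightarrow>
      (\<exists>ys. length ys = Suc d \<and> (\<forall>y\<in>set ys. y < B xs) \<and> R (ys @ xs))" (is "?l \<longleftrightarrow> ?r")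
    proof
      assume ?l
      then obtain y ys where "y < B xs" "length ys = d" "\<forall>y\<in>set ys. y < B xs" "R (ys @ y # xs)" by auto
      then show ?r by (intro exI[of _ "ys @ [y]"]) auto
    next
      assume ?r
      then obtain ys where ys: "length ys = Suc d" "\<forall>y\<in>set ys. y < B xs" "R (ys @ xs)" by blast
      then obtain zs y where "ys = zs @ [y]" by (cases ys rule: rev_cases) auto
      with ys show ?l by (intro exI[of _ y] conjI exI[of _ zs]) auto
    qed
  qed
qed

text \<open>Membership says that a binary digit is 1, i.e. that a quotient by a power of two is odd.
  Two inequalities pin down the quotient \<open>2 * j + 1\<close>, and \<open>j\<close> is at most
  \<open>n\<close>, which leaves a bounded search without division.\<close>

lemma decidable_set_decode:
  assumes "computable k F" "computable k N"
  shows "decidable k (\<lambda>xs. F xs \<in> set_decode (N xs))"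
proof -
  have eq: "c \<in> set_decode n \<longleftrightarrow> (\<exists>j<Suc n. (2 * j + 1) * 2 ^ c \<le> n \<and> n < (2 * j + 2) * 2 ^ c)" for c n
  proof
    assume "c \<in> set_decode n"
    then obtain j where j: "n div 2 ^ c = 2 * j + 1" by (auto simp: set_decode_def elim: oddE)
    have "j < Suc n" using j div_le_dividend[of n "2 ^ c"] by linarith
    moreover have "(2 * j + 1) * 2 ^ c \<le> n" using j div_times_less_eq_dividend[of n "2 ^ c"] by simp
    moreover have "n < (2 * j + 2) * 2 ^ c"
      using j dividend_less_div_times[of "2 ^ c" n] by (simp add: algebra_simps)
    ultimately show "\<exists>j<Suc n. (2 * j + 1) * 2 ^ c \<le> n \<and> n < (2 * j + 2) * 2 ^ c" by blast
  next
    assume "\<exists>j<Suc n. (2 * j + 1) * 2 ^ c \<le> n \<and> n < (2 * j + 2) * 2 ^ c"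
    then obtain j where "(2 * j + 1) * 2 ^ c \<le> n" "n < (2 * j + 2) * 2 ^ c" by blast
    then have "n div 2 ^ c = 2 * j + 1" by (intro div_nat_eqI) (simp_all add: algebra_simps)
    then show "c \<in> set_decode n" by (simp add: set_decode_def)
  qed
  have "decidable k (\<lambda>xs. \<exists>j<Suc (N xs). (\<lambda>ys. (2 * (ys ! 0) + 1) * 2 ^ F (tl ys) \<le> N (tl ys) \<and>
     N (tl ys) < (2 * (ys ! 0) + 2) * 2 ^ F (tl ys)) (j # xs))"
    by (intro decidable_ex_less decidable_conj decidable_le decidable_less computable_mult computable_add
        computable_power2 computable_tl computable_const computable_nth computable_Suc assms) simp_all
  then show ?thesis by (simp add: eq)
qed

text \<open>The code is a bounded sum of powers of two weighted by truth values.\<close>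

lemma computable_set_encode:
  assumes "decidable (Suc k) R" "computable k B"
  shows "computable k (\<lambda>xs. set_encode {c. c < B xs \<and> R (c # xs)})"
proof -
  have "computable k (\<lambda>xs. \<Sum>y<B xs. (\<lambda>ys. of_bool (R ys) * 2 ^ (ys ! 0)) (y # xs))"
    using assms unfolding decidable_def
    by (intro computable_sum_less computable_mult computable_power2 computable_nth) simp_all
  moreover have "set_encode {c. c < b \<and> Q c} = (\<Sum>y<b. of_bool (Q y) * 2 ^ y)" for b and Q :: "nat \<Rightarrow> bool"
  proof -
    have "(\<Sum>y<b. of_bool (Q y) * 2 ^ y) = (\<Sum>y<b. if Q y then 2 ^ y else 0 :: nat)"
      by (rule sum.cong) simp_all
    also have "\<dots> = (\<Sum>y\<in>{y \<in> {..<b}. Q y}. 2 ^ y)"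
      by (subst sum.inter_filter) simp_all
    also have "\<dots> = set_encode {c. c < b \<and> Q c}"
      unfolding set_encode_def by (rule sum.cong) auto
    finally show ?thesis ..
  qed
  ultimately show ?thesis by simp
qed

section \<open>Codes of global states\<close>

text \<open>Inverse to listing the values along \<open>ss\<close>; the default 0 elsewhere is what
  \<open>configs\<close> demands.\<close>

definition cfg :: "'s list \<Rightarrow> nat list \<Rightarrow> 's \<Rightarrow> nat" where
  "cfg ss xs s = (case map_of (zip ss xs) s of None \<Rightarrow> 0 | Some x \<Rightarrow> x)"

lemma cfg_nth: "distinct ss \<Longrightarrow> length xs = length ss \<Longrightarrow> i < length ss \<Longrightarrow> cfg ss xs (ss ! i) = xs ! i"
  by (simp add: cfg_def map_of_zip_nth)

lemma cfg_notin: "s \<notin> set ss \<Longrightarrow> cfg ss xs s = 0"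
  by (auto simp: cfg_def split: option.splits dest!: map_of_SomeD set_zip_leftD)

lemma map_cfg: "distinct ss \<Longrightarrow> length xs = length ss \<Longrightarrow> map (cfg ss xs) ss = xs"
  by (rule nth_equalityI) (simp_all add: cfg_nth)

lemma cfg_map:
  assumes "distinct ss" "\<And>s. s \<notin> set ss \<Longrightarrow> q s = 0"
  shows "cfg ss (map q ss) = q"
proof
  show "cfg ss (map q ss) s = q s" for s
  proof (cases "s \<in> set ss")
    case True
    then obtain i where "i < length ss" "s = ss ! i" by (auto simp: in_set_conv_nth)
    then show ?thesis using assms(1) by (simp add: cfg_nth)
  next
    case False
    then show ?thesis using assms(2) by (simp add: cfg_notin)
  qed
qed

lemma computable_cfg:
  assumes "distinct ss" "length ss \<le> k"
  shows "computable k (\<lambda>zs. cfg ss (take (length ss) zs) s)"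
proof (cases "s \<in> set ss")
  case True
  then obtain i where i: "i < length ss" "s = ss ! i" by (auto simp: in_set_conv_nth)
  show ?thesis
  proof (rule computable_cong)
    show "computable k (\<lambda>zs. zs ! i)" using i assms(2) by (intro computable_nth) simp
    show "zs ! i = cfg ss (take (length ss) zs) s" if "length zs = k" for zs
      using i assms that by (simp add: cfg_nth)
  qed
next
  case False
  then show ?thesis by (simp add: cfg_notin computable_const)
qed

lemma computable_list_encode_take:
  assumes "d \<le> k"
  shows "computable k (\<lambda>zs. list_encode (take d zs))"
proof (rule computable_cong)
  show "computable k (\<lambda>zs. list_encode (map (\<lambda>F. F zs) (map (\<lambda>i zs. zs ! i) [0..<d])))"
    using assms by (intro computable_list_encode) (auto intro: computable_nth)
  show "list_encode (map (\<lambda>F. F zs) (map (\<lambda>i zs. zs ! i) [0..<d])) = list_encode (take d zs)"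
    if "length zs = k" for zs
    using assms that by (intro arg_cong[of _ _ list_encode] nth_equalityI) auto
qed

lemma le_list_encode: "x \<in> set xs \<Longrightarrow> x \<le> list_encode xs"
proof (induction xs)
  case (Cons y xs)
  then show ?case
    using le_prod_encode_1[of y "list_encode xs"] le_prod_encode_2[of "list_encode xs" y] by auto
qed simp

lemma prod_encode_mono: "a \<le> a' \<Longrightarrow> b \<le> b' \<Longrightarrow> prod_encode (a, b) \<le> prod_encode (a', b')"
  unfolding prod_encode_def triangle_def
  by (simp add: add_mono div_le_mono mult_le_mono)

lemma list_encode_le_replicate: "\<forall>x\<in>set xs. x \<le> n \<Longrightarrow> list_encode xs \<le> list_encode (replicate (length xs) n)"
  by (induction xs) (simp_all add: prod_encode_mono)

text \<open>The power \<open>2 ^ x\<close> is one of the summands and exceeds \<open>x\<close>. So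
  the code of a basis bounds the codes of its elements, and these bound the entries.\<close>

lemma le_set_encode:
  assumes "finite X" "x \<in> X"
  shows "x \<le> set_encode X"
proof -
  have "x < 2 ^ x" by (rule less_exp)
  also have "2 ^ x \<le> set_encode X"
    unfolding set_encode_def using assms by (intro member_le_sum) auto
  finally show ?thesis by simp
qed

section \<open>Predecessors\<close>

context gsp
begin

text \<open>The same senders \<open>I\<close> fire in \<open>q0\<close>. The excess of
  \<open>N\<close> over \<open>n\<close> is larger than the arity, so a local state cut down to
  \<open>N\<close> still holds more than \<open>n\<close> processes after sending.\<close>

lemma step_truncate:
  assumes "a \<in> global_actions P" "step_by P a q q'" "b \<in> configs P" "config_le P b q'"
    and b: "\<And>s. b s \<le> n" and N: "n + arity P a < N"
  defines "q0 \<equiv> \<lambda>s. min (q s) N"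
  shows "\<exists>q0'. step_by P a q0 q0' \<and> config_le P b q0'"
proof -
  from assms(2) obtain I where I: "q \<in> configs P" "supp q \<subseteq> guard_of P a" "I \<in> senders a"
    "\<And>t. t \<in> states P \<Longrightarrow> src_vec P a I t = min (q t) (src_vec P a {1..arity P a} t)" "q' = fire P a I q"
    unfolding step_by_iff by blast
  have IK: "I \<subseteq> {1..arity P a}" using I(3) by (auto simp: senders_def)
  then have fin: "finite I" by (rule finite_subset) simp
  have v: "src_vec P a I t \<le> arity P a" for t using IK by (rule src_vec_le)
  have "N > 0" using N by simp
  then have supp: "supp q0 = supp q" by (auto simp: q0_def supp_def)
  have "q0 \<in> configs P" using I(1) by (simp add: q0_def configs_def)
  moreover have "src_vec P a I t = min (q0 t) (src_vec P a {1..arity P a} t)" if "t \<in> states P" for t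
    using I(4)[OF that] src_vec_le[OF order_refl, of a t] N by (simp add: q0_def min_def)
  ultimately have "step_by P a q0 (fire P a I q0)"
    unfolding step_by_iff using I(2,3) supp by auto
  moreover have "config_le P b (fire P a I q0)"
  proof -
    \<comment> \<open>At most \<open>arity P a\<close> processes send from a state and
      \<open>N\<close> is larger, so the cut does not affect which states keep a receiver.\<close>
    have "src_vec P a I s < q0 s \<longleftrightarrow> src_vec P a I s < q s" for s
      using v[of s] N by (auto simp: q0_def)
    then have "supp (fire P a I q0) = supp q'"
      unfolding supp_def I(5) fire_pos_iff[OF fin] by simp
    moreover have "b t \<le> fire P a I q0 t" if t: "t \<in> states P" for t
    \<comment> \<open>Either a state that was cut passes its receivers on to \<open>t\<close>, and
      these alone exceed \<open>b t\<close>, or nothing that flows into \<open>t\<close> was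
      cut.\<close>
    proof (cases "\<exists>s\<in>states P. recv_state P a s = t \<and> N < q s")
      case True
      then obtain s where s: "s \<in> states P" "recv_state P a s = t" "N < q s" by blast
      have "b t \<le> q0 s - src_vec P a I s"
        using b[of t] v[of s] N s(3) by (simp add: q0_def)
      also have "\<dots> \<le> recv_map P a (\<lambda>s. q0 s - src_vec P a I s) t"
        unfolding recv_map_def using s by (intro member_le_sum) auto
      finally show ?thesis by (simp add: fire_def)
    next
      case False
      then have "q0 s = q s" if "s \<in> states P" "recv_state P a s = t" for s
        using that by (auto simp: q0_def min_def)
      then have "recv_map P a (\<lambda>s. q0 s - src_vec P a I s) t = recv_map P a (\<lambda>s. q s - src_vec P a I s) t"
        unfolding recv_map_def by (intro sum.cong) auto
      then have "fire P a I q0 t = q' t" by (simp add: fire_def I(5))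
      then show ?thesis using assms(4) t by (simp add: config_le_def)
    qed
    ultimately show ?thesis using assms(4) by (simp add: config_le_def)
  qed
  ultimately show ?thesis by blast
qed

lemma config_le_truncate: "0 < N \<Longrightarrow> config_le P (\<lambda>s. min (q s) N) q"
  by (simp add: config_le_def supp_def)

text \<open>For \<open>n\<close> the code of a basis this is membership in its upward closure,
  phrased through codes so that it can be decided from \<open>n\<close>.\<close>

definition above :: "'s list \<Rightarrow> nat \<Rightarrow> ('s \<Rightarrow> nat) \<Rightarrow> bool" where
  "above ss n q \<longleftrightarrow> (\<exists>b\<in>configs P. config_code ss b \<in> set_decode n \<and> config_le P b q)"

definition pred_above :: "'s list \<Rightarrow> nat \<Rightarrow> ('s \<Rightarrow> nat) \<Rightarrow> bool" where
  "pred_above ss n q \<longleftrightarrow> (\<exists>q'. step P q q' \<and> above ss n q')"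

text \<open>Exceeds every arity; a sum also covers a process without actions.\<close>

definition action_bound :: nat where
  "action_bound = Suc (\<Sum>a\<in>global_actions P. arity P a)"

text \<open>Here \<open>n\<close> serves both as the code of a basis and as a bound for its
  entries.\<close>

definition pred_basis :: "'s list \<Rightarrow> nat \<Rightarrow> ('s \<Rightarrow> nat) set" where
  "pred_basis ss n = {q \<in> configs P. (\<forall>s. q s \<le> n + action_bound) \<and> pred_above ss n q}"

lemma computable_fire:
  assumes "\<And>s. computable k (\<lambda>xs. qf xs s)"
  shows "computable k (\<lambda>xs. fire P a I (qf xs) t)"
  unfolding fire_def recv_map_def
  by (intro computable_add computable_sum_finite computable_diff computable_const assms) simp

lemma decidable_supp_subset:
  assumes "\<And>s. computable k (\<lambda>xs. qf xs s)" "\<And>xs. qf xs \<in> configs P"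
  shows "decidable k (\<lambda>xs. supp (qf xs) \<subseteq> G)"
proof (rule decidable_cong)
  show "decidable k (\<lambda>xs. \<forall>s\<in>states P. 0 < qf xs s \<longrightarrow> s \<in> G)"
    by (intro decidable_ball decidable_imp decidable_pos decidable_const assms(1)) simp
  show "(\<forall>s\<in>states P. 0 < qf xs s \<longrightarrow> s \<in> G) \<longleftrightarrow> supp (qf xs) \<subseteq> G" for xs
    using supp_configs[OF assms(2)[of xs]] by (auto simp: supp_def)
qed

lemma decidable_config_le:
  assumes "\<And>s. computable k (\<lambda>xs. qf xs s)" "\<And>xs. qf xs \<in> configs P"
    and "\<And>s. computable k (\<lambda>xs. pf xs s)" "\<And>xs. pf xs \<in> configs P"
  shows "decidable k (\<lambda>xs. config_le P (qf xs) (pf xs))"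
  unfolding config_le_def
  by (intro decidable_conj decidable_ball decidable_le decidable_iff decidable_supp_subset assms) simp_all

section \<open>Decision procedures along an enumeration of the local states\<close>

context
  fixes ss :: "'s list"
  assumes ss: "distinct ss" "set ss = states P"
begin

lemma cfg_configs: "cfg ss xs \<in> configs P"
  using ss by (simp add: configs_def cfg_notin)

lemma config_code_cfg: "length xs = length ss \<Longrightarrow> config_code ss (cfg ss xs) = list_encode xs"
  using ss by (simp add: config_code_def map_cfg)

lemma cfg_map_configs: "q \<in> configs P \<Longrightarrow> cfg ss (map q ss) = q"
  using ss by (intro cfg_map) (auto simp: configs_def)

lemma config_code_inj: "inj_on (config_code ss) (configs P)"
  by (rule inj_onI) (metis cfg_map_configs config_code_def list_encode_eq)

lemma config_le_code:
  assumes "q \<in> configs P"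
  shows "q s \<le> config_code ss q"
proof (cases "s \<in> states P")
  case True
  then show ?thesis using ss unfolding config_code_def by (intro le_list_encode) auto
next
  case False
  then show ?thesis using assms by (simp add: configs_def)
qed

text \<open>Codes in \<open>set_decode n\<close> are at most \<open>n\<close>, and so are the
  entries of the coded states; this makes the search for \<open>b\<close> bounded.\<close>

lemma above_iff:
  "above ss n q \<longleftrightarrow> (\<exists>ys. length ys = length ss \<and> (\<forall>y\<in>set ys. y < Suc n) \<and>
    list_encode ys \<in> set_decode n \<and> config_le P (cfg ss ys) q)" (is "_ \<longleftrightarrow> ?r")
proof
  assume "above ss n q"
  then obtain b where b: "b \<in> configs P" "config_code ss b \<in> set_decode n" "config_le P b q"
    by (auto simp: above_def)
  have "config_code ss b \<le> n"
    using le_set_encode[OF finite_set_decode b(2)] by simp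
  then have "b s < Suc n" for s using config_le_code[OF b(1), of s] by simp
  with b show ?r
    by (intro exI[of _ "map b ss"]) (simp add: cfg_map_configs config_code_def)
next
  assume ?r
  then show "above ss n q" unfolding above_def
    by (metis cfg_configs config_code_cfg)
qed

lemma decidable_above:
  assumes "\<And>s. computable k (\<lambda>xs. qf xs s)" "\<And>xs. qf xs \<in> configs P" "computable k nf"
  shows "decidable k (\<lambda>xs. above ss (nf xs) (qf xs))"
proof (rule decidable_cong)
  let ?d = "length ss"
  let ?R = "\<lambda>zs. list_encode (take ?d zs) \<in> set_decode (nf (drop ?d zs)) \<and>
    config_le P (cfg ss (take ?d zs)) (qf (drop ?d zs))"
  show "decidable k (\<lambda>xs. \<exists>ys. length ys = ?d \<and> (\<forall>y\<in>set ys. y < Suc (nf xs)) \<and> ?R (ys @ xs))"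
    by (intro decidable_ex_list decidable_conj decidable_set_decode decidable_config_le
        computable_list_encode_take computable_cfg computable_Suc assms cfg_configs ss(1)
        computable_drop[of k nf] computable_drop[of k "\<lambda>xs. qf xs _"]) simp_all
  show "(\<exists>ys. length ys = ?d \<and> (\<forall>y\<in>set ys. y < Suc (nf xs)) \<and> ?R (ys @ xs)) \<longleftrightarrow>
    above ss (nf xs) (qf xs)" for xs
    unfolding above_iff by (intro ex_cong1) auto
qed

text \<open>A successor is determined by an action and a set of senders, so its existence is a
  finite disjunction fixed by the process.\<close>

lemma decidable_pred_above:
  assumes "\<And>s. computable k (\<lambda>xs. qf xs s)" "\<And>xs. qf xs \<in> configs P" "computable k nf"
  shows "decidable k (\<lambda>xs. pred_above ss (nf xs) (qf xs))"
proof (rule decidable_cong)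
  let ?v = "\<lambda>a. src_vec P a {1..arity P a}"
  have min: "computable k (\<lambda>xs. min (qf xs t) c)" for t c
  proof -
    have "computable k (\<lambda>xs. qf xs t - (qf xs t - c))"
      by (intro computable_diff computable_const assms)
    then show ?thesis by (rule computable_cong[rotated]) simp
  qed
  show "decidable k (\<lambda>xs. \<exists>a\<in>global_actions P. supp (qf xs) \<subseteq> guard_of P a \<and>
    (\<exists>I\<in>senders a. (\<forall>t\<in>states P. src_vec P a I t = min (qf xs t) (?v a t)) \<and>
      above ss (nf xs) (fire P a I (qf xs))))"
    by (intro decidable_bex decidable_conj decidable_supp_subset decidable_ball decidable_eq
        decidable_above computable_fire computable_const min assms fire_configs)
      (simp_all add: senders_def)
  show "(\<exists>a\<in>global_actions P. supp (qf xs) \<subseteq> guard_of P a \<and>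
    (\<exists>I\<in>senders a. (\<forall>t\<in>states P. src_vec P a I t = min (qf xs t) (?v a t)) \<and>
      above ss (nf xs) (fire P a I (qf xs)))) \<longleftrightarrow> pred_above ss (nf xs) (qf xs)" for xs
    unfolding pred_above_def step_def step_by_iff using assms(2)[of xs] by blast
qed

text \<open>Brings the codes into the shape that \<open>computable_set_encode\<close> handles. The
  largest possible code belongs to the list whose entries are all maximal.\<close>

lemma pred_basis_code:
  "config_code ss ` pred_basis ss n =
    {c. c < Suc (list_encode (replicate (length ss) (n + action_bound))) \<and>
      (\<exists>ys. length ys = length ss \<and> (\<forall>y\<in>set ys. y < Suc (n + action_bound)) \<and>
        list_encode ys = c \<and> pred_above ss n (cfg ss ys))}" (is "?l = ?r")
proof
  show "?l \<subseteq> ?r"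
  proof
    fix c assume "c \<in> ?l"
    then obtain q where q: "q \<in> configs P" "\<And>s. q s \<le> n + action_bound" "pred_above ss n q"
      "c = config_code ss q" by (auto simp: pred_basis_def)
    moreover have "list_encode (map q ss) \<le> list_encode (replicate (length (map q ss)) (n + action_bound))"
      using q(2) by (intro list_encode_le_replicate) simp
    ultimately show "c \<in> ?r"
      by (auto simp: config_code_def cfg_map_configs less_Suc_eq_le intro!: exI[of _ "map q ss"])
  qed
  show "?r \<subseteq> ?l"
  proof
    fix c assume "c \<in> ?r"
    then obtain ys where ys: "length ys = length ss" "\<And>y. y \<in> set ys \<Longrightarrow> y \<le> n + action_bound"
      "list_encode ys = c" "pred_above ss n (cfg ss ys)" by (auto simp: less_Suc_eq_le)
    have "cfg ss ys s \<le> n + action_bound" for s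
    proof (cases "s \<in> set ss")
      case True
      then have "cfg ss ys s \<in> set (map (cfg ss ys) ss)" by simp
      then show ?thesis using ys(1,2) ss(1) by (simp only: map_cfg)
    qed (simp add: cfg_notin)
    then have "cfg ss ys \<in> pred_basis ss n" using ys(4) by (simp add: pred_basis_def cfg_configs)
    then show "c \<in> ?l" using ys(1,3) config_code_cfg by force
  qed
qed

lemma computable_pred_basis:
  "computable 1 (\<lambda>xs. set_encode (config_code ss ` pred_basis ss (xs ! 0)))"
proof -
  let ?d = "length ss"
  let ?B = "\<lambda>xs :: nat list. Suc (list_encode (map (\<lambda>F. F xs) (replicate ?d (\<lambda>xs. xs ! 0 + action_bound))))"
  \<comment> \<open>The arguments are the list \<open>ys\<close> of length \<open>?d\<close>, the
    candidate code at position \<open>?d\<close> and \<open>n\<close> at position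
    \<open>Suc ?d\<close>.\<close>
  let ?Q = "\<lambda>zs. list_encode (take ?d zs) = zs ! ?d \<and> pred_above ss (zs ! Suc ?d) (cfg ss (take ?d zs))"
  let ?R = "\<lambda>zs. \<exists>ys. length ys = ?d \<and> (\<forall>y\<in>set ys. y < Suc (zs ! 1 + action_bound)) \<and> ?Q (ys @ zs)"
  have "decidable (Suc 1) ?R"
    by (intro decidable_ex_list decidable_conj decidable_eq decidable_pred_above computable_cfg cfg_configs
        computable_list_encode_take computable_nth computable_Suc computable_add computable_const ss(1))
      simp_all
  moreover have "computable 1 ?B"
    by (intro computable_Suc computable_list_encode) (auto intro!: computable_add computable_nth computable_const)
  ultimately have "computable 1 (\<lambda>xs. set_encode {c. c < ?B xs \<and> ?R (c # xs)})"
    by (rule computable_set_encode)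
  then show ?thesis
  proof (rule computable_cong[rotated])
    fix xs :: "nat list" assume "length xs = 1"
    then obtain n where "xs = [n]" by (auto simp: length_Suc_conv)
    moreover have "?R [c, n] \<longleftrightarrow> (\<exists>ys. length ys = ?d \<and> (\<forall>y\<in>set ys. y < Suc (n + action_bound)) \<and>
      list_encode ys = c \<and> pred_above ss n (cfg ss ys))" for c
      by (intro ex_cong1 conj_cong) (simp_all add: nth_append)
    ultimately show "set_encode {c. c < ?B xs \<and> ?R (c # xs)} = set_encode (config_code ss ` pred_basis ss (xs ! 0))"
      unfolding pred_basis_code by simp
  qed
qed

section \<open>Correctness of the computed basis\<close>

lemma above_basis:
  assumes "B \<subseteq> configs P" "finite B" "q \<in> configs P"
  shows "above ss (set_encode (config_code ss ` B)) q \<longleftrightarrow> q \<in> up (configs P) (config_le P) B"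
proof -
  \<comment> \<open>The code is injective on \<open>configs P\<close>, so decoding recovers exactly
    \<open>B\<close>.\<close>
  have "b \<in> configs P \<and> config_code ss b \<in> config_code ss ` B \<longleftrightarrow> b \<in> B" for b
    using assms(1) config_code_inj by (auto dest: inj_onD)
  then show ?thesis using assms by (auto simp: above_def up_def)
qed

lemma finite_pred_basis: "finite (pred_basis ss n)"
proof -
  have "finite (config_code ss ` pred_basis ss n)"
    unfolding pred_basis_code by (rule finite_subset[of _ "{..<Suc (list_encode (replicate (length ss) (n + action_bound)))}"]) auto
  moreover have "inj_on (config_code ss) (pred_basis ss n)"
    by (rule inj_on_subset[OF config_code_inj]) (auto simp: pred_basis_def)
  ultimately show ?thesis by (rule finite_imageD)
qed

lemma effective_pred_config_le:
  "effective_pred (config_code ss) (configs P) (step P) (config_le P)"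
proof -
  let ?Q = "configs P" and ?le = "config_le P"
  obtain f where "\<forall>xs. length xs = 1 \<longrightarrow>
      rec_eval f xs = Some (set_encode (config_code ss ` pred_basis ss (xs ! 0)))"
    using computable_pred_basis unfolding computable_def by blast
  then have f: "rec_eval f [n] = Some (set_encode (config_code ss ` pred_basis ss n))" for n
    by simp
  show ?thesis unfolding effective_pred_def
  proof (intro exI[of _ f] allI impI)
    fix U B
    assume asm: "up_closed ?Q ?le U \<and> finite_basis ?Q ?le B U"
    let ?n = "set_encode (config_code ss ` B)"
    have UB: "U \<subseteq> ?Q" "up ?Q ?le B = U" "finite B" "B \<subseteq> ?Q"
      using asm by (auto simp: up_closed_def finite_basis_def)
    have U: "q \<in> U \<longleftrightarrow> above ss ?n q" if "q \<in> ?Q" for q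
      using above_basis[OF UB(4,3) that] UB(2) by simp
    have pred: "q \<in> pred_set ?Q (step P) U \<longleftrightarrow> pred_above ss ?n q" for q
      unfolding pred_set_def pred_above_def using U step_configs by auto
    have sub: "pred_basis ss ?n \<subseteq> pred_set ?Q (step P) U"
      using pred by (auto simp: pred_basis_def)
    \<comment> \<open>A predecessor lies above its truncation, which is again a predecessor by
      \<open>step_truncate\<close>.\<close>
    have cover: "\<exists>p\<in>pred_basis ss ?n. ?le p q" if q: "q \<in> pred_set ?Q (step P) U" for q
    proof -
      obtain q' a where a: "a \<in> global_actions P" "step_by P a q q'" "above ss ?n q'"
        using q unfolding pred pred_above_def step_def by blast
      then obtain b where b: "b \<in> ?Q" "config_code ss b \<in> set_decode ?n" "?le b q'"
        by (auto simp: above_def)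
      \<comment> \<open>An entry is bounded by the code of its state, and this code by the code of
        the basis.\<close>
      have "b s \<le> ?n" for s
        using le_set_encode[OF finite_set_decode b(2)] config_le_code[OF b(1), of s] by simp
      moreover have "?n + arity P a < ?n + action_bound"
        using member_le_sum[OF a(1), of "arity P"] by (simp add: action_bound_def less_Suc_eq_le)
      ultimately obtain q0' where q0': "step_by P a (\<lambda>s. min (q s) (?n + action_bound)) q0'" "?le b q0'"
        using step_truncate[OF a(1,2) b(1,3)] by blast
      have "above ss ?n q0'" using b q0'(2) by (auto simp: above_def)
      moreover have "step P (\<lambda>s. min (q s) (?n + action_bound)) q0'"
        using q0'(1) a(1) by (auto simp: step_def)
      ultimately have "(\<lambda>s. min (q s) (?n + action_bound)) \<in> pred_basis ss ?n"
        using step_configs by (auto simp: pred_basis_def pred_above_def)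
      moreover have "?le (\<lambda>s. min (q s) (?n + action_bound)) q"
        by (rule config_le_truncate) (simp add: action_bound_def)
      ultimately show ?thesis by blast
    qed
    have "up ?Q ?le (pred_basis ss ?n) = up ?Q ?le (pred_set ?Q (step P) U)"
    proof
      show "up ?Q ?le (pred_basis ss ?n) \<subseteq> up ?Q ?le (pred_set ?Q (step P) U)"
        using sub by (auto simp: up_def)
      show "up ?Q ?le (pred_set ?Q (step P) U) \<subseteq> up ?Q ?le (pred_basis ss ?n)"
      proof
        fix p assume "p \<in> up ?Q ?le (pred_set ?Q (step P) U)"
        then obtain q where "p \<in> ?Q" "q \<in> pred_set ?Q (step P) U" "?le q p" by (auto simp: up_def)
        with cover show "p \<in> up ?Q ?le (pred_basis ss ?n)"
          unfolding up_def using config_le_trans by blast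
      qed
    qed
    moreover have "pred_basis ss ?n \<subseteq> up ?Q ?le (pred_set ?Q (step P) U)"
      using sub config_le_refl by (auto simp: up_def pred_basis_def)
    ultimately have "finite_basis ?Q ?le (pred_basis ss ?n) (up ?Q ?le (pred_set ?Q (step P) U))"
      using finite_pred_basis by (simp add: finite_basis_def)
    then show "\<exists>B'. B' \<subseteq> pred_set ?Q (step P) U \<and>
      finite_basis ?Q ?le B' (up ?Q ?le (pred_set ?Q (step P) U)) \<and>
      rec_eval f [?n] = Some (set_encode (config_code ss ` B'))"
      using sub f by blast
  qed
qed

end

end

theorem theorem3:
  fixes P :: "('s, 'a) gsp"
  assumes "gsp_process P"
    and "well_behaved P"
  shows "wsts (configs P) (step P) (config_le P) \<and>
    (\<forall>ss. distinct ss \<and> set ss = states P \<longrightarrow>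
       effective_pred (config_code ss) (configs P) (step P) (config_le P))"
proof -
  interpret gsp P by standard (rule assms(1))
  show ?thesis using wsts_config_le[OF assms(2)] effective_pred_config_le by blast
qed

end
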